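(* Let $V$ be a vector space of dimension $2k$ over the finite field $\mathbb{F}_q$ of order $q$, where $k\ge 1$, let $m$ be a positive integer such that $m<2k$, and let $k_1\le k_2$ be non-negative integers such that $(k_1,k_2)$ is admissible for $(m,k)$. Then the subspace-bisection geometry $\mathrm{Proj}_{(m,k)}^{(k_1,k_2)}(V)$ is collinearly complete if and only if $3k_2\le k+1+m+k_1$ and $(q,m,k,k_1,k_2)\ne (2,1,1,0,0)$.
   Context: A bisection of a $2k$-dimensional vector space $V$ is an unordered pair $\{V_1,V_2\}$ of subspaces with $V=V_1\oplus V_2$ and $\dim V_1=\dim V_2=k$. The subspace-bisection geometry $\mathrm{Proj}_{(m,k)}^{(k_1,k_2)}(V)$ has as points all $m$-dimensional subspaces of $V$, as lines all bisections of $V$, and a point $U$ is incident with a line $\{V_1,V_2\}$ if and only if $(\dim(U\cap V_1),\dim(U\cap V_2))$ equals $(k_1,k_2)$ or $(k_2,k_1)$. The pair $(k_1,k_2)$ with $k_1\le k_2$ is admissible for $(m,k)$ if at least one incident point-line pair exists, that is, if $\max\{0,m-k\}\le k_1\le k_2$ and $k_1+k_2\le m$. A point/line geometry is collinearly complete if each pair of distinct points is incident with at least one common line. *)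

theory Defs
  imports "HOL.Vector_Spaces" "HOL-Library.Cardinality"
begin

record ('p, 'l) point_line_geometry =
  points :: "'p set"
  lines :: "'l set"
  incident :: "'p \<Rightarrow> 'l \<Rightarrow> bool"

definition collinearly_complete :: "('p, 'l) point_line_geometry \<Rightarrow> bool" where
  "collinearly_complete G \<longleftrightarrow>
     (\<forall>p \<in> points G. \<forall>p' \<in> points G. p \<noteq> p' \<longrightarrow>
        (\<exists>l \<in> lines G. incident G p l \<and> incident G p' l))"

context vector_space
begin

text \<open>
  The vector space \<open>V\<close> is the whole type \<open>'b\<close>. The constant \<^const>\<open>dim\<close> is \<open>0\<close> on infinite-dimensional
  sets, so the notions below are meaningful when \<open>dim UNIV = 2 * k\<close> with \<open>k \<ge> 1\<close>, an equation
  that forces \<open>V\<close> to be finite-dimensional.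
\<close>

definition direct_sum_decomposition :: "'b set \<Rightarrow> 'b set \<Rightarrow> bool" where
  "direct_sum_decomposition V\<^sub>1 V\<^sub>2 \<longleftrightarrow>
     subspace V\<^sub>1 \<and> subspace V\<^sub>2 \<and> {x + y | x y. x \<in> V\<^sub>1 \<and> y \<in> V\<^sub>2} = UNIV \<and> V\<^sub>1 \<inter> V\<^sub>2 = {0}"

definition bisections :: "nat \<Rightarrow> 'b set set set" where
  "bisections k =
     {{V\<^sub>1, V\<^sub>2} | V\<^sub>1 V\<^sub>2. direct_sum_decomposition V\<^sub>1 V\<^sub>2 \<and> dim V\<^sub>1 = k \<and> dim V\<^sub>2 = k}"

definition subspace_bisection_geometry ::
    "nat \<Rightarrow> nat \<Rightarrow> nat \<Rightarrow> nat \<Rightarrow> ('b set, 'b set set) point_line_geometry" where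
  "subspace_bisection_geometry m k k\<^sub>1 k\<^sub>2 =
     \<lparr>points = {U. subspace U \<and> dim U = m},
      lines = bisections k,
      incident = (\<lambda>U L. \<exists>V\<^sub>1 V\<^sub>2. L = {V\<^sub>1, V\<^sub>2} \<and>
        ((dim (U \<inter> V\<^sub>1), dim (U \<inter> V\<^sub>2)) = (k\<^sub>1, k\<^sub>2) \<or>
         (dim (U \<inter> V\<^sub>1), dim (U \<inter> V\<^sub>2)) = (k\<^sub>2, k\<^sub>1)))\<rparr>"

text \<open>
  Admissibility is existence of an incident point-line pair. When \<open>dim UNIV = 2 * k\<close> with \<open>k \<ge> 1\<close>
  and \<open>0 < m < 2 * k\<close>, it depends only on the numbers:
  it amounts to \<open>max 0 (m - k) \<le> k\<^sub>1 \<le> k\<^sub>2\<close> (integer subtraction) and \<open>k\<^sub>1 + k\<^sub>2 \<le> m\<close>.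
\<close>

definition admissible :: "nat \<Rightarrow> nat \<Rightarrow> nat \<Rightarrow> nat \<Rightarrow> bool" where
  "admissible m k k\<^sub>1 k\<^sub>2 \<longleftrightarrow> k\<^sub>1 \<le> k\<^sub>2 \<and>
     (\<exists>U \<in> points (subspace_bisection_geometry m k k\<^sub>1 k\<^sub>2).
      \<exists>L \<in> lines (subspace_bisection_geometry m k k\<^sub>1 k\<^sub>2).
        incident (subspace_bisection_geometry m k k\<^sub>1 k\<^sub>2) U L)"

end

end

theory Submission
  imports Defs
begin

text \<open>
  Let \<open>U, U'\<close> be distinct points and \<open>i = dim (U \<inter> U')\<close>. If a common line \<open>{V\<^sub>1, V\<^sub>2}\<close> meets \<open>U\<close> and \<open>U'\<close> in
  the same order of dimensions, then two subspaces of dimension \<open>k\<^sub>2\<close> of the same half give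
  \<open>i \<ge> 2 * k\<^sub>2 - k\<close>; if it meets them in opposite order, then \<open>i \<le> m - (k\<^sub>2 - k\<^sub>1)\<close>. The inequality
  \<open>3 * k\<^sub>2 \<le> k + 1 + m + k\<^sub>1\<close> says that no \<open>i\<close> escapes both conditions, and when it fails
  \<open>i = m - (k\<^sub>2 - k\<^sub>1) + 1\<close> does.

  Conversely, each of the two conditions suffices. Choose a basis of \<open>V\<close> adapted to \<open>U \<inter> U'\<close>, \<open>U\<close> and
  \<open>U'\<close>, cut it into blocks of size at most 6, bisect the span of each block explicitly, and add up: all
  the dimensions involved are additive over direct sums. The single block that cannot be bisected, over
  the field with two elements, is two distinct lines in a plane with neither meeting \<open>V\<^sub>1\<close> or \<open>V\<^sub>2\<close>; it
  can be merged with a neighbouring block unless it is all of \<open>V\<close>.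
\<close>

section \<open>Explicit spans and coordinates\<close>

text \<open>Peeling off one generator at a time turns membership in the span of a listed finite set
  into an existential over coefficients, which can then be compared coordinate by
  coordinate.\<close>

lemma (in vector_space) span_insert_iff:
  "v \<in> span (insert g S) \<longleftrightarrow> (\<exists>k u. u \<in> span S \<and> v = scale k g + u)"
proof -
  have "v - scale k g \<in> span S \<longleftrightarrow> (\<exists>u. u \<in> span S \<and> v = scale k g + u)" for k
    by (auto intro: exI[of _ "v - scale k g"])
  then show ?thesis by (simp add: span_breakdown_eq)
qed

lemma (in vector_space) span_diff_left:
  "x - y \<in> span S \<Longrightarrow> y \<in> span S \<Longrightarrow> x \<in> span S"
  using span_add[of "x - y" S y] by simp

lemma (in vector_space) span_diff_right:
  "x - y \<in> span S \<Longrightarrow> x \<in> span S \<Longrightarrow> y \<in> span S"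
  using span_diff[of x S "x - y"] by simp

context finite_dimensional_vector_space
begin

text \<open>An independent \<open>E\<close> may span less than the whole space. Extending it to a
  basis first makes each coordinate a linear functional on all vectors.\<close>

definition coord :: "'b set \<Rightarrow> 'b \<Rightarrow> 'b \<Rightarrow> 'a" where
  "coord E e v = representation (extend_basis E) v e"

lemma coord_simps:
  assumes "independent E"
  shows "coord E e (x + y) = coord E e x + coord E e y"
    and "coord E e (x - y) = coord E e x - coord E e y"
    and "coord E e (scale c x) = c * coord E e x"
    and "coord E e 0 = 0"
    and "x \<in> E \<Longrightarrow> coord E e x = (if x = e then 1 else 0)"
  using independent_extend_basis[OF assms] extend_basis_superset[OF assms]
  by (auto simp: coord_def representation_add representation_diff representation_scale
      representation_basis span_extend_basis[OF assms] representation_zero)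

lemma coord_span_eq_0:
  assumes E: "independent E" and "S \<subseteq> E" "e \<notin> S" "v \<in> span S"
  shows "coord E e v = 0"
  using assms(4)
proof (induction rule: span_induct_alt)
  case base
  show ?case by (simp add: coord_simps[OF E])
next
  case (step c x y)
  then have "x \<in> E" "x \<noteq> e" using assms by auto
  with step show ?case by (simp add: coord_simps[OF E])
qed

text \<open>Vectors of \<open>span S\<close> have zero coordinates at \<open>E - S\<close>, so
  triviality of the intersection becomes a system of linear equations in the coefficients over
  \<open>T\<close>.\<close>

lemma dim_Int_eq_0:
  assumes "independent E" "S \<subseteq> E"
    and "\<And>v. v \<in> span T \<Longrightarrow> \<forall>e \<in> E. e \<notin> S \<longrightarrow> coord E e v = 0 \<Longrightarrow> v = 0"
  shows "dim (span S \<inter> span T) = 0"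
  using assms coord_span_eq_0[OF assms(1,2)] by (auto simp: dim_eq_0)

lemma dim_Int_eq_1:
  assumes "independent E" "S \<subseteq> E" "s \<noteq> 0" "s \<in> span S" "s \<in> span T"
    and "\<And>v. v \<in> span T \<Longrightarrow> \<forall>e \<in> E. e \<notin> S \<longrightarrow> coord E e v = 0 \<Longrightarrow> \<exists>c. v = scale c s"
  shows "dim (span S \<inter> span T) = 1"
proof -
  have "span S \<inter> span T = span {s}"
  proof (intro equalityI subsetI)
    fix v assume v: "v \<in> span S \<inter> span T"
    then have "\<forall>e \<in> E. e \<notin> S \<longrightarrow> coord E e v = 0"
      using coord_span_eq_0[OF assms(1,2)] by blast
    with v assms(6) obtain c where "v = scale c s" by blast
    then show "v \<in> span {s}" by (simp add: span_base span_scale)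
  next
    fix v assume "v \<in> span {s}"
    with assms(4,5) show "v \<in> span S \<inter> span T" by (auto simp: span_singleton span_scale)
  qed
  with assms(3) show ?thesis by simp
qed

section \<open>Blocks and their bisections\<close>

text \<open>
  In a frame, \<open>ws\<close> is a basis of \<open>U \<inter> U'\<close>, extended by \<open>as\<close> to \<open>U\<close>, by \<open>bs\<close> to \<open>U'\<close> and by
  \<open>as\<close>, \<open>bs\<close>, \<open>cs\<close> to the whole block.
\<close>

definition frame :: "'b list \<Rightarrow> 'b list \<Rightarrow> 'b list \<Rightarrow> 'b list \<Rightarrow> bool" where
  "frame ws as bs cs \<longleftrightarrow> distinct (ws @ as @ bs @ cs) \<and> independent (set (ws @ as @ bs @ cs))"

text \<open>Directness of the sum enters through dimensions: when
  \<open>d\<^sub>1 + d\<^sub>2\<close> is the dimension of the block, two subspaces that together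
  span it meet only in 0. The spans of \<open>ws @ as\<close> and \<open>ws @ bs\<close> are the
  traces of \<open>U\<close> and \<open>U'\<close> on the block.\<close>

definition splits :: "'b list \<Rightarrow> 'b list \<Rightarrow> 'b list \<Rightarrow> 'b list \<Rightarrow> 'b set \<Rightarrow> 'b set \<Rightarrow>
    nat \<Rightarrow> nat \<Rightarrow> nat \<Rightarrow> nat \<Rightarrow> nat \<Rightarrow> nat \<Rightarrow> bool" where
  "splits ws as bs cs V\<^sub>1 V\<^sub>2 d\<^sub>1 d\<^sub>2 x\<^sub>1 x\<^sub>2 y\<^sub>1 y\<^sub>2 \<longleftrightarrow>
     subspace V\<^sub>1 \<and> subspace V\<^sub>2 \<and> span (V\<^sub>1 \<union> V\<^sub>2) = span (set (ws @ as @ bs @ cs)) \<and>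
     dim V\<^sub>1 = d\<^sub>1 \<and> dim V\<^sub>2 = d\<^sub>2 \<and>
     dim (span (set (ws @ as)) \<inter> V\<^sub>1) = x\<^sub>1 \<and> dim (span (set (ws @ as)) \<inter> V\<^sub>2) = x\<^sub>2 \<and>
     dim (span (set (ws @ bs)) \<inter> V\<^sub>1) = y\<^sub>1 \<and> dim (span (set (ws @ bs)) \<inter> V\<^sub>2) = y\<^sub>2"

text \<open>Quantifying over all frames of given lengths leaves a statement about numbers alone:
  \<open>i\<close> is the dimension of \<open>U \<inter> U'\<close>, \<open>r\<close> its
  codimension in \<open>U\<close> and in \<open>U'\<close>, and \<open>c\<close> the codimension of
  the sum of \<open>U\<close> and \<open>U'\<close>.\<close>

definition splittable ::
    "nat \<Rightarrow> nat \<Rightarrow> nat \<Rightarrow> nat \<Rightarrow> nat \<Rightarrow> nat \<Rightarrow> nat \<Rightarrow> nat \<Rightarrow> nat \<Rightarrow> bool" where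
  "splittable i r c d\<^sub>1 d\<^sub>2 x\<^sub>1 x\<^sub>2 y\<^sub>1 y\<^sub>2 \<longleftrightarrow>
     (\<forall>ws as bs cs. frame ws as bs cs \<longrightarrow> length ws = i \<longrightarrow> length as = r \<longrightarrow> length bs = r \<longrightarrow>
        length cs = c \<longrightarrow> (\<exists>V\<^sub>1 V\<^sub>2. splits ws as bs cs V\<^sub>1 V\<^sub>2 d\<^sub>1 d\<^sub>2 x\<^sub>1 x\<^sub>2 y\<^sub>1 y\<^sub>2))"

text \<open>The vectors \<open>gs @ hs\<close> span the block and are as many as its dimension,
  hence independent, so the halves have the lengths of the lists as dimensions. Separate names for
  the sets allow literal finite sets in the applications.\<close>

lemma splits_spanI:
  assumes fr: "frame ws as bs cs"
    and eqs: "set (ws @ as) = X" "set (ws @ bs) = Y" "set (ws @ as @ bs @ cs) = E"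
    and sp: "E \<subseteq> span D" and D: "set (gs @ hs) = D"
    and GH: "set gs = G" "set hs = H" "length gs = d\<^sub>1" "length hs = d\<^sub>2"
    and len: "length gs + length hs = length (ws @ as @ bs @ cs)"
    and dims: "dim (span X \<inter> span G) = x\<^sub>1" "dim (span X \<inter> span H) = x\<^sub>2"
      "dim (span Y \<inter> span G) = y\<^sub>1" "dim (span Y \<inter> span H) = y\<^sub>2"
  shows "splits ws as bs cs (span G) (span H) d\<^sub>1 d\<^sub>2 x\<^sub>1 x\<^sub>2 y\<^sub>1 y\<^sub>2"
proof -
  let ?E = "set (ws @ as @ bs @ cs)" and ?G = "set gs \<union> set hs"
  have dE: "dim ?E = length gs + length hs"
    using fr len dim_eq_card_independent[of ?E] distinct_card[of "ws @ as @ bs @ cs"]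
    unfolding frame_def by simp
  have c: "card (set gs) \<le> length gs" "card (set hs) \<le> length hs"
    "card ?G \<le> card (set gs) + card (set hs)"
    using card_length card_Un_le by auto
  have "dim ?E \<le> dim ?G"
    using dim_mono[OF sp] D eqs by simp
  moreover have "dim ?G \<le> card ?G"
    by (rule dim_le_card) (auto simp: span_superset)
  \<comment> \<open>The chain from the dimension of the block through \<open>dim ?G\<close>,
    \<open>card ?G\<close> and the two cardinalities ends at the dimension of the block again, so
    equality holds throughout.\<close>
  ultimately have dG: "dim ?G = length gs + length hs" "card ?G = length gs + length hs"
    and cG: "card (set gs) = length gs" "card (set hs) = length hs"
    using dE c by linarith+
  have "span ?E \<subseteq> span ?G"
    using sp D eqs by (intro span_minimal) auto
  then have "span ?E = span ?G"
    by (intro subspace_dim_equal) (use dE dG in auto)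
  moreover have "span (span (set gs) \<union> span (set hs)) = span ?G"
    by (simp add: span_Un span_span)
  moreover have "independent ?G"
    by (rule card_le_dim_spanning[of _ "span ?G"]) (use dG in \<open>auto simp: span_superset\<close>)
  then have i: "independent (set gs)" "independent (set hs)"
    by (meson independent_mono sup_ge1 sup_ge2)+
  ultimately show ?thesis
    using dims dim_span_eq_card_independent[OF i(1)] dim_span_eq_card_independent[OF i(2)] cG
    unfolding splits_def eqs[symmetric] GH[symmetric] by simp
qed

section \<open>Explicit bisections of small blocks\<close>

text \<open>In the names of these blocks, \<open>u\<close> is a line of \<open>U\<close> inside a
  half, \<open>f\<close> a line of a half outside \<open>U\<close>, and \<open>e\<close> a plane in
  which \<open>U\<close> and both halves are distinct lines. In \<open>u_f\<close> the two lines
  belong to different halves. A final numeral is the codimension of \<open>U \<inter> U'\<close> in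
  \<open>U\<close>.\<close>

lemma splittable_u: "splittable 1 0 0 1 0 1 0 1 0"
  unfolding splittable_def
proof (intro allI impI)
  fix ws as bs cs
  assume fr: "frame ws as bs cs"
    and "length ws = 1" "length as = 0" "length bs = 0" "length cs = 0"
  then obtain w where e: "ws = [w]" "as = []" "bs = []" "cs = []"
    by (auto simp: length_Suc_conv numeral_eq_Suc)
  from fr e have E: "independent {w}" and d: "distinct [w]"
    by (simp_all add: frame_def)
  note c = coord_simps[OF E] span_insert_iff
  have nz: "w \<noteq> 0"
    using E d dependent_zero by auto
  let ?S = "span {w}"
  have "w \<in> ?S"
    by (simp_all add: span_base)
  then have S: "{w} \<subseteq> ?S"
    using span_diff_left span_diff_right by blast
  have "splits ws as bs cs (span {w}) (span {}) 1 0 1 0 1 0"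
  proof (rule splits_spanI[OF fr _ _ _ S, of "{w}" "{w}" "[w]" "[]"])
    show "dim (span {w} \<inter> span {w}) = 1"
    proof (rule dim_Int_eq_1[OF E, of _ "w"])
      show "w \<in> span {w}" "w \<in> span {w}"
        by (auto intro: span_diff span_base)
    qed (use d nz in \<open>auto simp: c\<close>)
    show "dim (span {w} \<inter> span {}) = 0"
      by (rule dim_Int_eq_0[OF E]) (use d in \<open>auto simp: c\<close>)
    show "dim (span {w} \<inter> span {w}) = 1"
    proof (rule dim_Int_eq_1[OF E, of _ "w"])
      show "w \<in> span {w}" "w \<in> span {w}"
        by (auto intro: span_diff span_base)
    qed (use d nz in \<open>auto simp: c\<close>)
    show "dim (span {w} \<inter> span {}) = 0"
      by (rule dim_Int_eq_0[OF E]) (use d in \<open>auto simp: c\<close>)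
  qed (auto simp: e)
  then show "\<exists>V\<^sub>1 V\<^sub>2. splits ws as bs cs V\<^sub>1 V\<^sub>2 1 0 1 0 1 0"
    by blast
qed

lemma splittable_f: "splittable 0 0 1 1 0 0 0 0 0"
  unfolding splittable_def
proof (intro allI impI)
  fix ws as bs cs
  assume fr: "frame ws as bs cs"
    and "length ws = 0" "length as = 0" "length bs = 0" "length cs = 1"
  then obtain c where e: "ws = []" "as = []" "bs = []" "cs = [c]"
    by (auto simp: length_Suc_conv numeral_eq_Suc)
  from fr e have E: "independent {c}" and d: "distinct [c]"
    by (simp_all add: frame_def)
  note c = coord_simps[OF E] span_insert_iff
  let ?S = "span {c}"
  have "c \<in> ?S"
    by (simp_all add: span_base)
  then have S: "{c} \<subseteq> ?S"
    using span_diff_left span_diff_right by blast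
  have "splits ws as bs cs (span {c}) (span {}) 1 0 0 0 0 0"
  proof (rule splits_spanI[OF fr _ _ _ S, of "{}" "{}" "[c]" "[]"])
    show "dim (span {} \<inter> span {c}) = 0"
      by (rule dim_Int_eq_0[OF E]) (use d in \<open>auto simp: c\<close>)
    show "dim (span {} \<inter> span {}) = 0"
      by (rule dim_Int_eq_0[OF E]) (use d in \<open>auto simp: c\<close>)
    show "dim (span {} \<inter> span {c}) = 0"
      by (rule dim_Int_eq_0[OF E]) (use d in \<open>auto simp: c\<close>)
    show "dim (span {} \<inter> span {}) = 0"
      by (rule dim_Int_eq_0[OF E]) (use d in \<open>auto simp: c\<close>)
  qed (auto simp: e)
  then show "\<exists>V\<^sub>1 V\<^sub>2. splits ws as bs cs V\<^sub>1 V\<^sub>2 1 0 0 0 0 0"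
    by blast
qed

lemma splittable_e: "splittable 1 0 1 1 1 0 0 0 0"
  unfolding splittable_def
proof (intro allI impI)
  fix ws as bs cs
  assume fr: "frame ws as bs cs"
    and "length ws = 1" "length as = 0" "length bs = 0" "length cs = 1"
  then obtain w c where e: "ws = [w]" "as = []" "bs = []" "cs = [c]"
    by (auto simp: length_Suc_conv numeral_eq_Suc)
  from fr e have E: "independent {w, c}" and d: "distinct [w, c]"
    by (simp_all add: frame_def)
  note c = coord_simps[OF E] span_insert_iff
  let ?S = "span {c, w - c}"
  have "c \<in> ?S" "w - c \<in> ?S"
    by (simp_all add: span_base)
  then have S: "{w, c} \<subseteq> ?S"
    using span_diff_left span_diff_right by blast
  have "splits ws as bs cs (span {c}) (span {w - c}) 1 1 0 0 0 0"
  proof (rule splits_spanI[OF fr _ _ _ S, of "{w}" "{w}" "[c]" "[w - c]"])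
    show "dim (span {w} \<inter> span {c}) = 0"
      by (rule dim_Int_eq_0[OF E]) (use d in \<open>auto simp: c\<close>)
    show "dim (span {w} \<inter> span {w - c}) = 0"
      by (rule dim_Int_eq_0[OF E]) (use d in \<open>auto simp: c\<close>)
    show "dim (span {w} \<inter> span {c}) = 0"
      by (rule dim_Int_eq_0[OF E]) (use d in \<open>auto simp: c\<close>)
    show "dim (span {w} \<inter> span {w - c}) = 0"
      by (rule dim_Int_eq_0[OF E]) (use d in \<open>auto simp: c\<close>)
  qed (auto simp: e)
  then show "\<exists>V\<^sub>1 V\<^sub>2. splits ws as bs cs V\<^sub>1 V\<^sub>2 1 1 0 0 0 0"
    by blast
qed

lemma splittable_uf_1: "splittable 0 1 0 2 0 1 0 1 0"
  unfolding splittable_def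
proof (intro allI impI)
  fix ws as bs cs
  assume fr: "frame ws as bs cs"
    and "length ws = 0" "length as = 1" "length bs = 1" "length cs = 0"
  then obtain a b where e: "ws = []" "as = [a]" "bs = [b]" "cs = []"
    by (auto simp: length_Suc_conv numeral_eq_Suc)
  from fr e have E: "independent {a, b}" and d: "distinct [a, b]"
    by (simp_all add: frame_def)
  note c = coord_simps[OF E] span_insert_iff
  have nz: "a \<noteq> 0" "b \<noteq> 0"
    using E d dependent_zero by auto
  let ?S = "span {a, b}"
  have "a \<in> ?S" "b \<in> ?S"
    by (simp_all add: span_base)
  then have S: "{a, b} \<subseteq> ?S"
    using span_diff_left span_diff_right by blast
  have "splits ws as bs cs (span {a, b}) (span {}) 2 0 1 0 1 0"
  proof (rule splits_spanI[OF fr _ _ _ S, of "{a}" "{b}" "[a, b]" "[]"])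
    show "dim (span {a} \<inter> span {a, b}) = 1"
    proof (rule dim_Int_eq_1[OF E, of _ "a"])
      show "a \<in> span {a}" "a \<in> span {a, b}"
        by (auto intro: span_diff span_base)
    qed (use d nz in \<open>auto simp: c\<close>)
    show "dim (span {a} \<inter> span {}) = 0"
      by (rule dim_Int_eq_0[OF E]) (use d in \<open>auto simp: c\<close>)
    show "dim (span {b} \<inter> span {a, b}) = 1"
    proof (rule dim_Int_eq_1[OF E, of _ "b"])
      show "b \<in> span {b}" "b \<in> span {a, b}"
        by (auto intro: span_diff span_base)
    qed (use d nz in \<open>auto simp: c\<close>)
    show "dim (span {b} \<inter> span {}) = 0"
      by (rule dim_Int_eq_0[OF E]) (use d in \<open>auto simp: c\<close>)
  qed (auto simp: e)
  then show "\<exists>V\<^sub>1 V\<^sub>2. splits ws as bs cs V\<^sub>1 V\<^sub>2 2 0 1 0 1 0"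
    by blast
qed

lemma splittable_swap: "splittable 0 1 0 1 1 0 1 1 0"
  unfolding splittable_def
proof (intro allI impI)
  fix ws as bs cs
  assume fr: "frame ws as bs cs"
    and "length ws = 0" "length as = 1" "length bs = 1" "length cs = 0"
  then obtain a b where e: "ws = []" "as = [a]" "bs = [b]" "cs = []"
    by (auto simp: length_Suc_conv numeral_eq_Suc)
  from fr e have E: "independent {a, b}" and d: "distinct [a, b]"
    by (simp_all add: frame_def)
  note c = coord_simps[OF E] span_insert_iff
  have nz: "a \<noteq> 0" "b \<noteq> 0"
    using E d dependent_zero by auto
  let ?S = "span {b, a}"
  have "b \<in> ?S" "a \<in> ?S"
    by (simp_all add: span_base)
  then have S: "{a, b} \<subseteq> ?S"
    using span_diff_left span_diff_right by blast
  have "splits ws as bs cs (span {b}) (span {a}) 1 1 0 1 1 0"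
  proof (rule splits_spanI[OF fr _ _ _ S, of "{a}" "{b}" "[b]" "[a]"])
    show "dim (span {a} \<inter> span {b}) = 0"
      by (rule dim_Int_eq_0[OF E]) (use d in \<open>auto simp: c\<close>)
    show "dim (span {a} \<inter> span {a}) = 1"
    proof (rule dim_Int_eq_1[OF E, of _ "a"])
      show "a \<in> span {a}" "a \<in> span {a}"
        by (auto intro: span_diff span_base)
    qed (use d nz in \<open>auto simp: c\<close>)
    show "dim (span {b} \<inter> span {b}) = 1"
    proof (rule dim_Int_eq_1[OF E, of _ "b"])
      show "b \<in> span {b}" "b \<in> span {b}"
        by (auto intro: span_diff span_base)
    qed (use d nz in \<open>auto simp: c\<close>)
    show "dim (span {b} \<inter> span {a}) = 0"
      by (rule dim_Int_eq_0[OF E]) (use d in \<open>auto simp: c\<close>)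
  qed (auto simp: e)
  then show "\<exists>V\<^sub>1 V\<^sub>2. splits ws as bs cs V\<^sub>1 V\<^sub>2 1 1 0 1 1 0"
    by blast
qed

text \<open>Two planes of a 3-space share the line of \<open>w\<close>. The first half is a plane
  avoiding \<open>w\<close>, so it cuts them in different lines; the line of \<open>a - b\<close>
  lies in none of the three planes.\<close>

lemma splittable_ue_1: "splittable 1 1 0 2 1 1 0 1 0"
  unfolding splittable_def
proof (intro allI impI)
  fix ws as bs cs
  assume fr: "frame ws as bs cs"
    and "length ws = 1" "length as = 1" "length bs = 1" "length cs = 0"
  then obtain w a b where e: "ws = [w]" "as = [a]" "bs = [b]" "cs = []"
    by (auto simp: length_Suc_conv numeral_eq_Suc)
  from fr e have E: "independent {w, a, b}" and d: "distinct [w, a, b]"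
    by (simp_all add: frame_def)
  note c = coord_simps[OF E] span_insert_iff
  have nz: "a \<noteq> 0" "b - w \<noteq> 0"
    using E d dependent_zero by auto
  let ?S = "span {a, b - w, a - b}"
  have "a \<in> ?S" "b - w \<in> ?S" "a - b \<in> ?S"
    by (simp_all add: span_base)
  then have S: "{w, a, b} \<subseteq> ?S"
    using span_diff_left span_diff_right by blast
  have "splits ws as bs cs (span {a, b - w}) (span {a - b}) 2 1 1 0 1 0"
  proof (rule splits_spanI[OF fr _ _ _ S, of "{w, a}" "{w, b}" "[a, b - w]" "[a - b]"])
    show "dim (span {w, a} \<inter> span {a, b - w}) = 1"
    proof (rule dim_Int_eq_1[OF E, of _ "a"])
      show "a \<in> span {w, a}" "a \<in> span {a, b - w}"
        by (auto intro: span_diff span_base)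
    qed (use d nz in \<open>auto simp: c\<close>)
    show "dim (span {w, a} \<inter> span {a - b}) = 0"
      by (rule dim_Int_eq_0[OF E]) (use d in \<open>auto simp: c\<close>)
    show "dim (span {w, b} \<inter> span {a, b - w}) = 1"
    proof (rule dim_Int_eq_1[OF E, of _ "b - w"])
      show "b - w \<in> span {w, b}" "b - w \<in> span {a, b - w}"
        by (auto intro: span_diff span_base)
    qed (use d nz in \<open>auto simp: c\<close>)
    show "dim (span {w, b} \<inter> span {a - b}) = 0"
      by (rule dim_Int_eq_0[OF E]) (use d in \<open>auto simp: c\<close>)
  qed (auto simp: e)
  then show "\<exists>V\<^sub>1 V\<^sub>2. splits ws as bs cs V\<^sub>1 V\<^sub>2 2 1 1 0 1 0"
    by blast
qed

text \<open>The first half consists of the vectors with coordinate sum zero and therefore contains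
  none of \<open>a\<close>, \<open>b\<close>, \<open>c\<close>.\<close>

lemma splittable_ef_1: "splittable 0 1 1 2 1 0 0 0 0"
  unfolding splittable_def
proof (intro allI impI)
  fix ws as bs cs
  assume fr: "frame ws as bs cs"
    and "length ws = 0" "length as = 1" "length bs = 1" "length cs = 1"
  then obtain a b c where e: "ws = []" "as = [a]" "bs = [b]" "cs = [c]"
    by (auto simp: length_Suc_conv numeral_eq_Suc)
  from fr e have E: "independent {a, b, c}" and d: "distinct [a, b, c]"
    by (simp_all add: frame_def)
  note c = coord_simps[OF E] span_insert_iff
  let ?S = "span {c - a, a - b, c}"
  have "c - a \<in> ?S" "a - b \<in> ?S" "c \<in> ?S"
    by (simp_all add: span_base)
  then have S: "{a, b, c} \<subseteq> ?S"
    using span_diff_left span_diff_right by blast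
  have "splits ws as bs cs (span {c - a, a - b}) (span {c}) 2 1 0 0 0 0"
  proof (rule splits_spanI[OF fr _ _ _ S, of "{a}" "{b}" "[c - a, a - b]" "[c]"])
    show "dim (span {a} \<inter> span {c - a, a - b}) = 0"
      by (rule dim_Int_eq_0[OF E]) (use d in \<open>auto simp: c\<close>)
    show "dim (span {a} \<inter> span {c}) = 0"
      by (rule dim_Int_eq_0[OF E]) (use d in \<open>auto simp: c\<close>)
    show "dim (span {b} \<inter> span {c - a, a - b}) = 0"
      by (rule dim_Int_eq_0[OF E]) (use d in \<open>auto simp: c\<close>)
    show "dim (span {b} \<inter> span {c}) = 0"
      by (rule dim_Int_eq_0[OF E]) (use d in \<open>auto simp: c\<close>)
  qed (auto simp: e)
  then show "\<exists>V\<^sub>1 V\<^sub>2. splits ws as bs cs V\<^sub>1 V\<^sub>2 2 1 0 0 0 0"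
    by blast
qed

lemma splittable_ee_1: "splittable 1 1 1 2 2 0 0 0 0"
  unfolding splittable_def
proof (intro allI impI)
  fix ws as bs cs
  assume fr: "frame ws as bs cs"
    and "length ws = 1" "length as = 1" "length bs = 1" "length cs = 1"
  then obtain w a b c where e: "ws = [w]" "as = [a]" "bs = [b]" "cs = [c]"
    by (auto simp: length_Suc_conv numeral_eq_Suc)
  from fr e have E: "independent {w, a, b, c}" and d: "distinct [w, a, b, c]"
    by (simp_all add: frame_def)
  note c = coord_simps[OF E] span_insert_iff
  let ?S = "span {w - (b - a), c, b - a, a - c}"
  have "w - (b - a) \<in> ?S" "c \<in> ?S" "b - a \<in> ?S" "a - c \<in> ?S"
    by (simp_all add: span_base)
  then have S: "{w, a, b, c} \<subseteq> ?S"
    using span_diff_left span_diff_right by blast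
  have "splits ws as bs cs (span {w - (b - a), c}) (span {b - a, a - c}) 2 2 0 0 0 0"
  proof (rule splits_spanI[OF fr _ _ _ S, of "{w, a}" "{w, b}" "[w - (b - a), c]" "[b - a, a - c]"])
    show "dim (span {w, a} \<inter> span {w - (b - a), c}) = 0"
      by (rule dim_Int_eq_0[OF E]) (use d in \<open>auto simp: c\<close>)
    show "dim (span {w, a} \<inter> span {b - a, a - c}) = 0"
      by (rule dim_Int_eq_0[OF E]) (use d in \<open>auto simp: c\<close>)
    show "dim (span {w, b} \<inter> span {w - (b - a), c}) = 0"
      by (rule dim_Int_eq_0[OF E]) (use d in \<open>auto simp: c\<close>)
    show "dim (span {w, b} \<inter> span {b - a, a - c}) = 0"
      by (rule dim_Int_eq_0[OF E]) (use d in \<open>auto simp: c\<close>)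
  qed (auto simp: e)
  then show "\<exists>V\<^sub>1 V\<^sub>2. splits ws as bs cs V\<^sub>1 V\<^sub>2 2 2 0 0 0 0"
    by blast
qed

text \<open>The vectors \<open>x - f x\<close>, for an isomorphism \<open>f\<close> from
  \<open>U\<close> to \<open>U'\<close>, form a complement of both; two such graphs meet trivially
  if the difference of the maps is injective. Relative to the first map, the second has
  characteristic polynomial x^2 - x - 1, and neither 0 nor 1 is a root of it over any field.\<close>

lemma splittable_ee_2: "splittable 0 2 0 2 2 0 0 0 0"
  unfolding splittable_def
proof (intro allI impI)
  fix ws as bs cs
  assume fr: "frame ws as bs cs"
    and "length ws = 0" "length as = 2" "length bs = 2" "length cs = 0"
  then obtain a a' b b' where e: "ws = []" "as = [a, a']" "bs = [b, b']" "cs = []"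
    by (auto simp: length_Suc_conv numeral_eq_Suc)
  from fr e have E: "independent {a, a', b, b'}" and d: "distinct [a, a', b, b']"
    by (simp_all add: frame_def)
  note c = coord_simps[OF E] span_insert_iff
  let ?S = "span {a - b, a' - b', a - b', a' - b' - b}"
  have "a - b \<in> ?S" "a' - b' \<in> ?S" "a - b' \<in> ?S" "a' - b' - b \<in> ?S"
    by (simp_all add: span_base)
  then have S: "{a, a', b, b'} \<subseteq> ?S"
    using span_diff_left span_diff_right by blast
  have "splits ws as bs cs (span {a - b, a' - b'}) (span {a - b', a' - b' - b}) 2 2 0 0 0 0"
  proof (rule splits_spanI[OF fr _ _ _ S, of "{a, a'}" "{b, b'}" "[a - b, a' - b']" "[a - b', a' - b' - b]"])
    show "dim (span {a, a'} \<inter> span {a - b, a' - b'}) = 0"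
      by (rule dim_Int_eq_0[OF E]) (use d in \<open>auto simp: c\<close>)
    show "dim (span {a, a'} \<inter> span {a - b', a' - b' - b}) = 0"
      by (rule dim_Int_eq_0[OF E]) (use d in \<open>auto simp: c\<close>)
    show "dim (span {b, b'} \<inter> span {a - b, a' - b'}) = 0"
      by (rule dim_Int_eq_0[OF E]) (use d in \<open>auto simp: c\<close>)
    show "dim (span {b, b'} \<inter> span {a - b', a' - b' - b}) = 0"
      by (rule dim_Int_eq_0[OF E]) (use d in \<open>auto simp: c\<close>)
  qed (auto simp: e)
  then show "\<exists>V\<^sub>1 V\<^sub>2. splits ws as bs cs V\<^sub>1 V\<^sub>2 2 2 0 0 0 0"
    by blast
qed

text \<open>The same construction with the polynomial x^3 - x - 1. Sums of blocks of sizes 2 and 3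
  reach every size from 2 on, over every field.\<close>

lemma splittable_eee_3: "splittable 0 3 0 3 3 0 0 0 0"
  unfolding splittable_def
proof (intro allI impI)
  fix ws as bs cs
  assume fr: "frame ws as bs cs"
    and "length ws = 0" "length as = 3" "length bs = 3" "length cs = 0"
  then obtain a a' a'' b b' b'' where e: "ws = []" "as = [a, a', a'']" "bs = [b, b', b'']" "cs = []"
    by (auto simp: length_Suc_conv numeral_eq_Suc)
  from fr e have E: "independent {a, a', a'', b, b', b''}" and d: "distinct [a, a', a'', b, b', b'']"
    by (simp_all add: frame_def)
  note c = coord_simps[OF E] span_insert_iff
  let ?S = "span {a - b, a' - b', a'' - b'', a - b', a' - b'', a'' - b - b'}"
  have "a - b \<in> ?S" "a' - b' \<in> ?S" "a'' - b'' \<in> ?S" "a - b' \<in> ?S" "a' - b'' \<in> ?S" "a'' - b - b' \<in> ?S"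
    by (simp_all add: span_base)
  then have S: "{a, a', a'', b, b', b''} \<subseteq> ?S"
    proof -
    assume m: "a - b \<in> ?S" "a' - b' \<in> ?S" "a'' - b'' \<in> ?S" "a - b' \<in> ?S" "a' - b'' \<in> ?S"
      "a'' - b - b' \<in> ?S"
    \<comment> \<open>The vector \<open>b\<close> is isolated by hand; from it, each remaining basis
      vector is reached through a single generator.\<close>
    have "b = (a'' - b'' - (a'' - b - b')) + (a' - b' - (a' - b''))"
      by simp
    also have "\<dots> \<in> ?S"
      by (rule span_add[OF span_diff[OF m(3,6)] span_diff[OF m(2,5)]])
    finally show ?thesis
      using m span_diff_left span_diff_right by blast
  qed
  have "splits ws as bs cs (span {a - b, a' - b', a'' - b''}) (span {a - b', a' - b'', a'' - b - b'}) 3 3 0 0 0 0"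
  proof (rule splits_spanI[OF fr _ _ _ S, of "{a, a', a''}" "{b, b', b''}" "[a - b, a' - b', a'' - b'']" "[a - b', a' - b'', a'' - b - b']"])
    show "dim (span {a, a', a''} \<inter> span {a - b, a' - b', a'' - b''}) = 0"
      by (rule dim_Int_eq_0[OF E]) (use d in \<open>auto simp: c\<close>)
    show "dim (span {a, a', a''} \<inter> span {a - b', a' - b'', a'' - b - b'}) = 0"
      by (rule dim_Int_eq_0[OF E]) (use d in \<open>auto simp: c\<close>)
    show "dim (span {b, b', b''} \<inter> span {a - b, a' - b', a'' - b''}) = 0"
      by (rule dim_Int_eq_0[OF E]) (use d in \<open>auto simp: c\<close>)
    show "dim (span {b, b', b''} \<inter> span {a - b', a' - b'', a'' - b - b'}) = 0"
      by (rule dim_Int_eq_0[OF E]) (use d in \<open>auto simp: c\<close>)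
  qed (auto simp: e)
  then show "\<exists>V\<^sub>1 V\<^sub>2. splits ws as bs cs V\<^sub>1 V\<^sub>2 3 3 0 0 0 0"
    by blast
qed

text \<open>A hyperplane containing neither plane cuts each of them in a line, and the line of
  \<open>a - b\<close> avoids the planes and the hyperplane. This block serves where splitting off
  \<open>splittable_uf_1\<close> would leave the impossible plane over the field with two
  elements.\<close>

lemma splittable_ufe_2: "splittable 0 2 0 3 1 1 0 1 0"
  unfolding splittable_def
proof (intro allI impI)
  fix ws as bs cs
  assume fr: "frame ws as bs cs"
    and "length ws = 0" "length as = 2" "length bs = 2" "length cs = 0"
  then obtain a a' b b' where e: "ws = []" "as = [a, a']" "bs = [b, b']" "cs = []"
    by (auto simp: length_Suc_conv numeral_eq_Suc)
  from fr e have E: "independent {a, a', b, b'}" and d: "distinct [a, a', b, b']"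
    by (simp_all add: frame_def)
  note c = coord_simps[OF E] span_insert_iff
  have nz: "a' \<noteq> 0" "b \<noteq> 0"
    using E d dependent_zero by auto
  let ?S = "span {b, a', a - b', a - b}"
  have "b \<in> ?S" "a' \<in> ?S" "a - b' \<in> ?S" "a - b \<in> ?S"
    by (simp_all add: span_base)
  then have S: "{a, a', b, b'} \<subseteq> ?S"
    using span_diff_left span_diff_right by blast
  have "splits ws as bs cs (span {b, a', a - b'}) (span {a - b}) 3 1 1 0 1 0"
  proof (rule splits_spanI[OF fr _ _ _ S, of "{a, a'}" "{b, b'}" "[b, a', a - b']" "[a - b]"])
    show "dim (span {a, a'} \<inter> span {b, a', a - b'}) = 1"
    proof (rule dim_Int_eq_1[OF E, of _ "a'"])
      show "a' \<in> span {a, a'}" "a' \<in> span {b, a', a - b'}"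
        by (auto intro: span_diff span_base)
    qed (use d nz in \<open>auto simp: c\<close>)
    show "dim (span {a, a'} \<inter> span {a - b}) = 0"
      by (rule dim_Int_eq_0[OF E]) (use d in \<open>auto simp: c\<close>)
    show "dim (span {b, b'} \<inter> span {b, a', a - b'}) = 1"
    proof (rule dim_Int_eq_1[OF E, of _ "b"])
      show "b \<in> span {b, b'}" "b \<in> span {b, a', a - b'}"
        by (auto intro: span_diff span_base)
    qed (use d nz in \<open>auto simp: c\<close>)
    show "dim (span {b, b'} \<inter> span {a - b}) = 0"
      by (rule dim_Int_eq_0[OF E]) (use d in \<open>auto simp: c\<close>)
  qed (auto simp: e)
  then show "\<exists>V\<^sub>1 V\<^sub>2. splits ws as bs cs V\<^sub>1 V\<^sub>2 3 1 1 0 1 0"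
    by blast
qed

lemma splittable_u_f_e_2: "splittable 0 2 0 2 2 1 0 1 0"
  unfolding splittable_def
proof (intro allI impI)
  fix ws as bs cs
  assume fr: "frame ws as bs cs"
    and "length ws = 0" "length as = 2" "length bs = 2" "length cs = 0"
  then obtain a a' b b' where e: "ws = []" "as = [a, a']" "bs = [b, b']" "cs = []"
    by (auto simp: length_Suc_conv numeral_eq_Suc)
  from fr e have E: "independent {a, a', b, b'}" and d: "distinct [a, a', b, b']"
    by (simp_all add: frame_def)
  note c = coord_simps[OF E] span_insert_iff
  have nz: "a \<noteq> 0" "b \<noteq> 0"
    using E d dependent_zero by auto
  let ?S = "span {a, b, a' - b, a - b'}"
  have "a \<in> ?S" "b \<in> ?S" "a' - b \<in> ?S" "a - b' \<in> ?S"
    by (simp_all add: span_base)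
  then have S: "{a, a', b, b'} \<subseteq> ?S"
    using span_diff_left span_diff_right by blast
  have "splits ws as bs cs (span {a, b}) (span {a' - b, a - b'}) 2 2 1 0 1 0"
  proof (rule splits_spanI[OF fr _ _ _ S, of "{a, a'}" "{b, b'}" "[a, b]" "[a' - b, a - b']"])
    show "dim (span {a, a'} \<inter> span {a, b}) = 1"
    proof (rule dim_Int_eq_1[OF E, of _ "a"])
      show "a \<in> span {a, a'}" "a \<in> span {a, b}"
        by (auto intro: span_diff span_base)
    qed (use d nz in \<open>auto simp: c\<close>)
    show "dim (span {a, a'} \<inter> span {a' - b, a - b'}) = 0"
      by (rule dim_Int_eq_0[OF E]) (use d in \<open>auto simp: c\<close>)
    show "dim (span {b, b'} \<inter> span {a, b}) = 1"
    proof (rule dim_Int_eq_1[OF E, of _ "b"])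
      show "b \<in> span {b, b'}" "b \<in> span {a, b}"
        by (auto intro: span_diff span_base)
    qed (use d nz in \<open>auto simp: c\<close>)
    show "dim (span {b, b'} \<inter> span {a' - b, a - b'}) = 0"
      by (rule dim_Int_eq_0[OF E]) (use d in \<open>auto simp: c\<close>)
  qed (auto simp: e)
  then show "\<exists>V\<^sub>1 V\<^sub>2. splits ws as bs cs V\<^sub>1 V\<^sub>2 2 2 1 0 1 0"
    by blast
qed

text \<open>The second half is a graph, hence a complement of both subspaces. The block serves where
  splitting off \<open>splittable_u_f_e_2\<close> would leave the impossible plane.\<close>

lemma splittable_u_f_ee_3: "splittable 0 3 0 3 3 1 0 1 0"
  unfolding splittable_def
proof (intro allI impI)
  fix ws as bs cs
  assume fr: "frame ws as bs cs"
    and "length ws = 0" "length as = 3" "length bs = 3" "length cs = 0"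
  then obtain a a' a'' b b' b'' where e: "ws = []" "as = [a, a', a'']" "bs = [b, b', b'']" "cs = []"
    by (auto simp: length_Suc_conv numeral_eq_Suc)
  from fr e have E: "independent {a, a', a'', b, b', b''}" and d: "distinct [a, a', a'', b, b', b'']"
    by (simp_all add: frame_def)
  note c = coord_simps[OF E] span_insert_iff
  have nz: "a'' \<noteq> 0" "b' \<noteq> 0"
    using E d dependent_zero by auto
  let ?S = "span {b - a', b', a'', a - b, a' - b', a'' - b''}"
  have "b - a' \<in> ?S" "b' \<in> ?S" "a'' \<in> ?S" "a - b \<in> ?S" "a' - b' \<in> ?S" "a'' - b'' \<in> ?S"
    by (simp_all add: span_base)
  then have S: "{a, a', a'', b, b', b''} \<subseteq> ?S"
    using span_diff_left span_diff_right by blast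
  have "splits ws as bs cs (span {b - a', b', a''}) (span {a - b, a' - b', a'' - b''}) 3 3 1 0 1 0"
  proof (rule splits_spanI[OF fr _ _ _ S, of "{a, a', a''}" "{b, b', b''}" "[b - a', b', a'']" "[a - b, a' - b', a'' - b'']"])
    show "dim (span {a, a', a''} \<inter> span {b - a', b', a''}) = 1"
    proof (rule dim_Int_eq_1[OF E, of _ "a''"])
      show "a'' \<in> span {a, a', a''}" "a'' \<in> span {b - a', b', a''}"
        by (auto intro: span_diff span_base)
    qed (use d nz in \<open>auto simp: c\<close>)
    show "dim (span {a, a', a''} \<inter> span {a - b, a' - b', a'' - b''}) = 0"
      by (rule dim_Int_eq_0[OF E]) (use d in \<open>auto simp: c\<close>)
    show "dim (span {b, b', b''} \<inter> span {b - a', b', a''}) = 1"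
    proof (rule dim_Int_eq_1[OF E, of _ "b'"])
      show "b' \<in> span {b, b', b''}" "b' \<in> span {b - a', b', a''}"
        by (auto intro: span_diff span_base)
    qed (use d nz in \<open>auto simp: c\<close>)
    show "dim (span {b, b', b''} \<inter> span {a - b, a' - b', a'' - b''}) = 0"
      by (rule dim_Int_eq_0[OF E]) (use d in \<open>auto simp: c\<close>)
  qed (auto simp: e)
  then show "\<exists>V\<^sub>1 V\<^sub>2. splits ws as bs cs V\<^sub>1 V\<^sub>2 3 3 1 0 1 0"
    by blast
qed

text \<open>Here the plane that cannot be bisected alone over the field with two elements is
  absorbed into a block of the type of \<open>splittable_swap\<close>.\<close>

lemma splittable_swap_e: "splittable 0 2 0 2 2 0 1 1 0"
  unfolding splittable_def
proof (intro allI impI)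
  fix ws as bs cs
  assume fr: "frame ws as bs cs"
    and "length ws = 0" "length as = 2" "length bs = 2" "length cs = 0"
  then obtain a a' b b' where e: "ws = []" "as = [a, a']" "bs = [b, b']" "cs = []"
    by (auto simp: length_Suc_conv numeral_eq_Suc)
  from fr e have E: "independent {a, a', b, b'}" and d: "distinct [a, a', b, b']"
    by (simp_all add: frame_def)
  note c = coord_simps[OF E] span_insert_iff
  have nz: "a \<noteq> 0" "b \<noteq> 0"
    using E d dependent_zero by auto
  let ?S = "span {b, a - b', a, a' - b}"
  have "b \<in> ?S" "a - b' \<in> ?S" "a \<in> ?S" "a' - b \<in> ?S"
    by (simp_all add: span_base)
  then have S: "{a, a', b, b'} \<subseteq> ?S"
    using span_diff_left span_diff_right by blast
  have "splits ws as bs cs (span {b, a - b'}) (span {a, a' - b}) 2 2 0 1 1 0"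
  proof (rule splits_spanI[OF fr _ _ _ S, of "{a, a'}" "{b, b'}" "[b, a - b']" "[a, a' - b]"])
    show "dim (span {a, a'} \<inter> span {b, a - b'}) = 0"
      by (rule dim_Int_eq_0[OF E]) (use d in \<open>auto simp: c\<close>)
    show "dim (span {a, a'} \<inter> span {a, a' - b}) = 1"
    proof (rule dim_Int_eq_1[OF E, of _ "a"])
      show "a \<in> span {a, a'}" "a \<in> span {a, a' - b}"
        by (auto intro: span_diff span_base)
    qed (use d nz in \<open>auto simp: c\<close>)
    show "dim (span {b, b'} \<inter> span {b, a - b'}) = 1"
    proof (rule dim_Int_eq_1[OF E, of _ "b"])
      show "b \<in> span {b, b'}" "b \<in> span {b, a - b'}"
        by (auto intro: span_diff span_base)
    qed (use d nz in \<open>auto simp: c\<close>)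
    show "dim (span {b, b'} \<inter> span {a, a' - b}) = 0"
      by (rule dim_Int_eq_0[OF E]) (use d in \<open>auto simp: c\<close>)
  qed (auto simp: e)
  then show "\<exists>V\<^sub>1 V\<^sub>2. splits ws as bs cs V\<^sub>1 V\<^sub>2 2 2 0 1 1 0"
    by blast
qed

text \<open>A third scalar \<open>t\<close> provides a fourth line of the plane, so that both halves
  can differ from \<open>U\<close> and \<open>U'\<close>.\<close>

lemma splittable_e_1:
  fixes t :: 'a
  assumes t: "t \<noteq> 0" "t \<noteq> 1"
  shows "splittable 0 1 0 1 1 0 0 0 0"
  unfolding splittable_def
proof (intro allI impI)
  fix ws as bs cs
  assume fr: "frame ws as bs cs"
    and "length ws = 0" "length as = 1" "length bs = 1" "length cs = 0"
  then obtain a b where e: "ws = []" "as = [a]" "bs = [b]" "cs = []"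
    by (auto simp: length_Suc_conv numeral_eq_Suc)
  from fr e have E: "independent {a, b}" and d: "distinct [a, b]"
    by (simp_all add: frame_def)
  note c = coord_simps[OF E] span_insert_iff
  let ?S = "span {a - b, a - scale t b}"
  have "a - b \<in> ?S" "a - scale t b \<in> ?S"
    by (simp_all add: span_base)
  then have S: "{a, b} \<subseteq> ?S"
    proof -
    assume m: "a - b \<in> ?S" "a - scale t b \<in> ?S"
    have "a - b - (a - scale t b) = scale (t - 1) b"
      by (simp add: scale_left_diff_distrib)
    then have "b = scale (1 / (t - 1)) (a - b - (a - scale t b))"
      using t by simp
    also have "\<dots> \<in> ?S"
      by (rule span_scale[OF span_diff[OF m]])
    finally show ?thesis
      using m span_diff_left by blast
  qed
  have "splits ws as bs cs (span {a - b}) (span {a - scale t b}) 1 1 0 0 0 0"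
  proof (rule splits_spanI[OF fr _ _ _ S, of "{a}" "{b}" "[a - b]" "[a - scale t b]"])
    show "dim (span {a} \<inter> span {a - b}) = 0"
      by (rule dim_Int_eq_0[OF E]) (use d t in \<open>auto simp: c\<close>)
    show "dim (span {a} \<inter> span {a - scale t b}) = 0"
      by (rule dim_Int_eq_0[OF E]) (use d t in \<open>auto simp: c\<close>)
    show "dim (span {b} \<inter> span {a - b}) = 0"
      by (rule dim_Int_eq_0[OF E]) (use d t in \<open>auto simp: c\<close>)
    show "dim (span {b} \<inter> span {a - scale t b}) = 0"
      by (rule dim_Int_eq_0[OF E]) (use d t in \<open>auto simp: c\<close>)
  qed (auto simp: e)
  then show "\<exists>V\<^sub>1 V\<^sub>2. splits ws as bs cs V\<^sub>1 V\<^sub>2 1 1 0 0 0 0"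
    by blast
qed

section \<open>Adding blocks along direct sums\<close>

lemma span_Un_subspaces:
  "subspace X \<Longrightarrow> subspace Y \<Longrightarrow> span (X \<union> Y) = {x + y | x y. x \<in> X \<and> y \<in> Y}"
  by (simp add: span_Un span_eq_iff[THEN iffD2])

lemma span_span_Un: "span (span S \<union> span T) = span (S \<union> T)"
  by (simp add: span_Un span_span)

lemma frame_append:
  assumes "frame (ws @ ws') (as @ as') (bs @ bs') (cs @ cs')"
  shows "frame ws as bs cs" "frame ws' as' bs' cs'"
    and "span (set (ws @ as @ bs @ cs)) \<inter> span (set (ws' @ as' @ bs' @ cs')) = {0}"
proof -
  let ?E = "set (ws @ as @ bs @ cs)" and ?E' = "set (ws' @ as' @ bs' @ cs')"
  have U: "set ((ws @ ws') @ (as @ as') @ (bs @ bs') @ (cs @ cs')) = ?E \<union> ?E'"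
    by auto
  have ind: "independent (?E \<union> ?E')"
    using assms unfolding frame_def U by blast
  then have i: "independent ?E" "independent ?E'"
    by (meson independent_mono sup_ge1 sup_ge2)+
  moreover have "distinct (ws @ as @ bs @ cs)" "distinct (ws' @ as' @ bs' @ cs')"
    and disj: "?E \<inter> ?E' = {}"
    using assms by (auto simp: frame_def)
  ultimately show "frame ws as bs cs" "frame ws' as' bs' cs'"
    by (simp_all add: frame_def)
  have "dim (span (?E \<union> ?E')) + dim (span ?E \<inter> span ?E') = dim (span ?E) + dim (span ?E')"
    using dim_sums_Int[OF subspace_span subspace_span, of ?E ?E']
    unfolding span_Un_subspaces[OF subspace_span subspace_span, symmetric] span_span_Un .
  moreover have "dim (span (?E \<union> ?E')) = dim (span ?E) + dim (span ?E')"
    using dim_span_eq_card_independent[OF ind] dim_span_eq_card_independent[OF i(1)]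
      dim_span_eq_card_independent[OF i(2)] card_Un_disjoint[OF _ _ disj] by simp
  ultimately have "dim (span ?E \<inter> span ?E') = 0"
    by linarith
  then show "span ?E \<inter> span ?E' = {0}"
    using span_zero by (auto simp: dim_eq_0)
qed

lemma dim_span_Un_direct:
  assumes "subspace X" "subspace Y" "X \<subseteq> S" "Y \<subseteq> T" "S \<inter> T = {0}"
  shows "dim (span (X \<union> Y)) = dim X + dim Y"
proof -
  have "dim (X \<inter> Y) = 0"
    using assms by (auto simp: dim_eq_0)
  then show ?thesis
    using dim_sums_Int[OF assms(1,2)] unfolding span_Un_subspaces[OF assms(1,2)] by linarith
qed

text \<open>Intersection distributes over these sums because components with respect to the direct
  sum of \<open>S\<close> and \<open>T\<close> are unique: a vector lying in both sums has the same
  two components in each.\<close>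

lemma span_Un_Int_direct:
  assumes sub: "subspace X" "subspace X'" "subspace Y" "subspace Y'" "subspace S" "subspace T"
    and incl: "X \<subseteq> S" "Y \<subseteq> S" "X' \<subseteq> T" "Y' \<subseteq> T" and ST: "S \<inter> T = {0}"
  shows "span (X \<union> X') \<inter> span (Y \<union> Y') = span ((X \<inter> Y) \<union> (X' \<inter> Y'))"
proof
  show "span (X \<inter> Y \<union> X' \<inter> Y') \<subseteq> span (X \<union> X') \<inter> span (Y \<union> Y')"
    by (auto intro: span_mono[THEN subsetD, rotated])
next
  show "span (X \<union> X') \<inter> span (Y \<union> Y') \<subseteq> span (X \<inter> Y \<union> X' \<inter> Y')"
  proof
    fix v assume "v \<in> span (X \<union> X') \<inter> span (Y \<union> Y')"
    then obtain x x' y y' where v: "v = x + x'" "v = y + y'"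
      and m: "x \<in> X" "x' \<in> X'" "y \<in> Y" "y' \<in> Y'"
      unfolding span_Un_subspaces[OF sub(1,2)] span_Un_subspaces[OF sub(3,4)] by blast
    have "x - y = y' - x'"
      using v by (metis add_diff_cancel_left' add_diff_eq diff_add_eq diff_diff_eq2)
    moreover have "x - y \<in> S" "y' - x' \<in> T"
      using m incl sub by (auto intro!: subspace_diff)
    ultimately have "x - y \<in> S \<inter> T" "y' - x' \<in> S \<inter> T"
      by auto
    then have "x = y" "x' = y'"
      using ST by auto
    then have "x \<in> X \<inter> Y \<union> X' \<inter> Y'" "x' \<in> X \<inter> Y \<union> X' \<inter> Y'"
      using m by auto
    then show "v \<in> span (X \<inter> Y \<union> X' \<inter> Y')"
      unfolding v(1) by (intro span_add span_base)
  qed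
qed

lemma splits_append:
  assumes fr: "frame (ws @ ws') (as @ as') (bs @ bs') (cs @ cs')"
    and V: "splits ws as bs cs V\<^sub>1 V\<^sub>2 d\<^sub>1 d\<^sub>2 x\<^sub>1 x\<^sub>2 y\<^sub>1 y\<^sub>2"
    and V': "splits ws' as' bs' cs' V\<^sub>1' V\<^sub>2' d\<^sub>1' d\<^sub>2' x\<^sub>1' x\<^sub>2' y\<^sub>1' y\<^sub>2'"
  shows "splits (ws @ ws') (as @ as') (bs @ bs') (cs @ cs') (span (V\<^sub>1 \<union> V\<^sub>1')) (span (V\<^sub>2 \<union> V\<^sub>2'))
    (d\<^sub>1 + d\<^sub>1') (d\<^sub>2 + d\<^sub>2') (x\<^sub>1 + x\<^sub>1') (x\<^sub>2 + x\<^sub>2') (y\<^sub>1 + y\<^sub>1') (y\<^sub>2 + y\<^sub>2')"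
proof -
  let ?S = "span (set (ws @ as @ bs @ cs))" and ?S' = "span (set (ws' @ as' @ bs' @ cs'))"
  note direct = frame_append(3)[OF fr]
  have sub: "subspace V\<^sub>1" "subspace V\<^sub>2" "subspace V\<^sub>1'" "subspace V\<^sub>2'"
    and sp: "span (V\<^sub>1 \<union> V\<^sub>2) = ?S" "span (V\<^sub>1' \<union> V\<^sub>2') = ?S'"
    using V V' by (auto simp: splits_def)
  have incl: "V\<^sub>1 \<subseteq> ?S" "V\<^sub>2 \<subseteq> ?S" "V\<^sub>1' \<subseteq> ?S'" "V\<^sub>2' \<subseteq> ?S'"
    using sp span_superset by blast+
  have dims: "dim (span (V \<union> V')) = dim V + dim V'"
    if "subspace V" "subspace V'" "V \<subseteq> ?S" "V' \<subseteq> ?S'" for V V'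
    using dim_span_Un_direct[OF that direct] .
  have ints: "dim (span (set (gs @ gs')) \<inter> span (V \<union> V')) =
      dim (span (set gs) \<inter> V) + dim (span (set gs') \<inter> V')"
    if "subspace V" "subspace V'" "V \<subseteq> ?S" "V' \<subseteq> ?S'"
      and gs: "set gs \<subseteq> set (ws @ as @ bs @ cs)" "set gs' \<subseteq> set (ws' @ as' @ bs' @ cs')"
    for V V' gs gs'
  proof -
    have "span (set (gs @ gs')) = span (span (set gs) \<union> span (set gs'))"
      by (simp only: span_span_Un set_append)
    then have "span (set (gs @ gs')) \<inter> span (V \<union> V') =
        span ((span (set gs) \<inter> V) \<union> (span (set gs') \<inter> V'))"
      using span_Un_Int_direct[of "span (set gs)" "span (set gs')" V V' ?S ?S'] that direct
        span_mono[OF gs(1)] span_mono[OF gs(2)] by simp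
    then show ?thesis
      using that dims[of "span (set gs) \<inter> V" "span (set gs') \<inter> V'"]
      by (auto simp: subspace_inter)
  qed
  have perm: "set ((ws @ ws') @ (as @ as')) = set ((ws @ as) @ (ws' @ as'))"
    "set ((ws @ ws') @ (bs @ bs')) = set ((ws @ bs) @ (ws' @ bs'))"
    by auto
  have "span (span (V\<^sub>1 \<union> V\<^sub>1') \<union> span (V\<^sub>2 \<union> V\<^sub>2')) =
      span ((V\<^sub>1 \<union> V\<^sub>2) \<union> (V\<^sub>1' \<union> V\<^sub>2'))"
    unfolding span_span_Un by (simp only: Un_ac)
  also have "\<dots> = span (?S \<union> ?S')"
    unfolding sp[symmetric] span_span_Un ..
  also have "\<dots> = span (set ((ws @ ws') @ (as @ as') @ (bs @ bs') @ (cs @ cs')))"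
    unfolding span_span_Un set_append by (simp only: Un_ac)
  finally have "span (span (V\<^sub>1 \<union> V\<^sub>1') \<union> span (V\<^sub>2 \<union> V\<^sub>2')) =
      span (set ((ws @ ws') @ (as @ as') @ (bs @ bs') @ (cs @ cs')))" .
  note sp' = this
  have gs: "set (ws @ as) \<subseteq> set (ws @ as @ bs @ cs)" "set (ws @ bs) \<subseteq> set (ws @ as @ bs @ cs)"
    "set (ws' @ as') \<subseteq> set (ws' @ as' @ bs' @ cs')" "set (ws' @ bs') \<subseteq> set (ws' @ as' @ bs' @ cs')"
    by auto
  show ?thesis
    using V V'
    unfolding splits_def perm sp' dims[OF sub(1,3) incl(1,3)] dims[OF sub(2,4) incl(2,4)]
      ints[OF sub(1,3) incl(1,3) gs(1,3)] ints[OF sub(2,4) incl(2,4) gs(1,3)]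
      ints[OF sub(1,3) incl(1,3) gs(2,4)] ints[OF sub(2,4) incl(2,4) gs(2,4)]
    by (elim conjE) (simp only: subspace_span simp_thms)
qed

text \<open>A frame of the combined lengths is cut into two frames whose spans meet trivially, and
  corresponding halves are joined.\<close>

lemma splittable_add:
  assumes "splittable i r c d\<^sub>1 d\<^sub>2 x\<^sub>1 x\<^sub>2 y\<^sub>1 y\<^sub>2" and "splittable i' r' c' d\<^sub>1' d\<^sub>2' x\<^sub>1' x\<^sub>2' y\<^sub>1' y\<^sub>2'"
  shows "splittable (i + i') (r + r') (c + c') (d\<^sub>1 + d\<^sub>1') (d\<^sub>2 + d\<^sub>2')
    (x\<^sub>1 + x\<^sub>1') (x\<^sub>2 + x\<^sub>2') (y\<^sub>1 + y\<^sub>1') (y\<^sub>2 + y\<^sub>2')"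
  unfolding splittable_def
proof (intro allI impI)
  fix ws as bs cs :: "'b list"
  assume fr: "frame ws as bs cs"
    and len: "length ws = i + i'" "length as = r + r'" "length bs = r + r'" "length cs = c + c'"
  define ws1 ws2 as1 as2 bs1 bs2 cs1 cs2 where
    split: "ws1 = take i ws" "ws2 = drop i ws" "as1 = take r as" "as2 = drop r as"
      "bs1 = take r bs" "bs2 = drop r bs" "cs1 = take c cs" "cs2 = drop c cs"
  have eqs: "ws = ws1 @ ws2" "as = as1 @ as2" "bs = bs1 @ bs2" "cs = cs1 @ cs2"
    by (simp_all add: split)
  have len': "length ws1 = i" "length as1 = r" "length bs1 = r" "length cs1 = c"
    "length ws2 = i'" "length as2 = r'" "length bs2 = r'" "length cs2 = c'"
    using len by (simp_all add: split)
  note fr' = fr[unfolded eqs]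
  obtain V\<^sub>1 V\<^sub>2 where "splits ws1 as1 bs1 cs1 V\<^sub>1 V\<^sub>2 d\<^sub>1 d\<^sub>2 x\<^sub>1 x\<^sub>2 y\<^sub>1 y\<^sub>2"
    using assms(1) frame_append(1)[OF fr'] len' unfolding splittable_def by blast
  moreover obtain V\<^sub>1' V\<^sub>2' where "splits ws2 as2 bs2 cs2 V\<^sub>1' V\<^sub>2' d\<^sub>1' d\<^sub>2' x\<^sub>1' x\<^sub>2' y\<^sub>1' y\<^sub>2'"
    using assms(2) frame_append(2)[OF fr'] len' unfolding splittable_def by blast
  ultimately show "\<exists>V\<^sub>1 V\<^sub>2. splits ws as bs cs V\<^sub>1 V\<^sub>2 (d\<^sub>1 + d\<^sub>1') (d\<^sub>2 + d\<^sub>2')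
      (x\<^sub>1 + x\<^sub>1') (x\<^sub>2 + x\<^sub>2') (y\<^sub>1 + y\<^sub>1') (y\<^sub>2 + y\<^sub>2')"
    unfolding eqs using splits_append[OF fr'] by blast
qed

lemma splittable_0: "splittable 0 0 0 0 0 0 0 0 0"
proof -
  have "splits [] [] [] [] {0} {0} 0 0 0 0 0 0"
    by (simp add: splits_def span_eq_iff[THEN iffD2])
  then show ?thesis
    unfolding splittable_def by auto
qed

lemma splittable_commute:
  assumes "splittable i r c d\<^sub>1 d\<^sub>2 x\<^sub>1 x\<^sub>2 y\<^sub>1 y\<^sub>2"
  shows "splittable i r c d\<^sub>2 d\<^sub>1 x\<^sub>2 x\<^sub>1 y\<^sub>2 y\<^sub>1"
proof -
  have "splits ws as bs cs V\<^sub>1 V\<^sub>2 d\<^sub>1 d\<^sub>2 x\<^sub>1 x\<^sub>2 y\<^sub>1 y\<^sub>2 \<longleftrightarrow>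
      splits ws as bs cs V\<^sub>2 V\<^sub>1 d\<^sub>2 d\<^sub>1 x\<^sub>2 x\<^sub>1 y\<^sub>2 y\<^sub>1" for ws as bs cs V\<^sub>1 V\<^sub>2
    unfolding splits_def Un_commute[of V\<^sub>1] by blast
  then have "(\<exists>V\<^sub>1 V\<^sub>2. splits ws as bs cs V\<^sub>1 V\<^sub>2 d\<^sub>1 d\<^sub>2 x\<^sub>1 x\<^sub>2 y\<^sub>1 y\<^sub>2) \<longleftrightarrow>
      (\<exists>V\<^sub>1 V\<^sub>2. splits ws as bs cs V\<^sub>1 V\<^sub>2 d\<^sub>2 d\<^sub>1 x\<^sub>2 x\<^sub>1 y\<^sub>2 y\<^sub>1)" for ws as bs cs
    by blast
  then show ?thesis
    using assms unfolding splittable_def by simp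
qed

section \<open>Bisections meeting both subspaces in the same dimensions\<close>

text \<open>
  The case where \<open>V\<^sub>1\<close> and \<open>V\<^sub>2\<close> meet \<open>U\<close> and \<open>U'\<close> in the same dimensions \<open>u\<^sub>1\<close> and \<open>u\<^sub>2\<close>. If \<open>U = U'\<close>
  (that is, \<open>r = 0\<close>), the block is a sum of \<open>u\<^sub>j\<close> lines \<open>U = V\<^sub>j\<close>, of \<open>f\<^sub>j\<close> lines \<open>V\<^sub>j\<close> with \<open>U = 0\<close>, and of \<open>e\<close>
  planes in which \<open>U\<close>, \<open>V\<^sub>1\<close>, \<open>V\<^sub>2\<close> are three distinct lines; \<open>r\<close> is the codimension of \<open>U \<inter> U'\<close> in \<open>U\<close>.
\<close>

definition aligned :: "nat \<Rightarrow> nat \<Rightarrow> nat \<Rightarrow> nat \<Rightarrow> nat \<Rightarrow> nat \<Rightarrow> bool" where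
  "aligned u\<^sub>1 u\<^sub>2 e f\<^sub>1 f\<^sub>2 r \<longleftrightarrow> r \<le> u\<^sub>1 + u\<^sub>2 + e \<and> r \<le> e + f\<^sub>1 + f\<^sub>2 \<and>
     splittable (u\<^sub>1 + u\<^sub>2 + e - r) r (e + f\<^sub>1 + f\<^sub>2 - r) (u\<^sub>1 + e + f\<^sub>1) (u\<^sub>2 + e + f\<^sub>2) u\<^sub>1 u\<^sub>2 u\<^sub>1 u\<^sub>2"

lemma splittable_cong:
  "splittable i r c d\<^sub>1 d\<^sub>2 x\<^sub>1 x\<^sub>2 y\<^sub>1 y\<^sub>2 \<Longrightarrow> i = i' \<Longrightarrow> r = r' \<Longrightarrow> c = c' \<Longrightarrow>
    d\<^sub>1 = d\<^sub>1' \<Longrightarrow> d\<^sub>2 = d\<^sub>2' \<Longrightarrow> x\<^sub>1 = x\<^sub>1' \<Longrightarrow> x\<^sub>2 = x\<^sub>2' \<Longrightarrow> y\<^sub>1 = y\<^sub>1' \<Longrightarrow> y\<^sub>2 = y\<^sub>2' \<Longrightarrow>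
    splittable i' r' c' d\<^sub>1' d\<^sub>2' x\<^sub>1' x\<^sub>2' y\<^sub>1' y\<^sub>2'"
  by simp

text \<open>The inequalities inside \<open>aligned\<close> keep its natural subtractions exact, so
  all six parameters add up componentwise.\<close>

lemma aligned_add:
  assumes "aligned u\<^sub>1 u\<^sub>2 e f\<^sub>1 f\<^sub>2 r" "aligned u\<^sub>1' u\<^sub>2' e' f\<^sub>1' f\<^sub>2' r'"
  shows "aligned (u\<^sub>1 + u\<^sub>1') (u\<^sub>2 + u\<^sub>2') (e + e') (f\<^sub>1 + f\<^sub>1') (f\<^sub>2 + f\<^sub>2') (r + r')"
proof -
  have "splittable (u\<^sub>1 + u\<^sub>2 + e - r + (u\<^sub>1' + u\<^sub>2' + e' - r')) (r + r')
      (e + f\<^sub>1 + f\<^sub>2 - r + (e' + f\<^sub>1' + f\<^sub>2' - r'))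
      (u\<^sub>1 + e + f\<^sub>1 + (u\<^sub>1' + e' + f\<^sub>1')) (u\<^sub>2 + e + f\<^sub>2 + (u\<^sub>2' + e' + f\<^sub>2'))
      (u\<^sub>1 + u\<^sub>1') (u\<^sub>2 + u\<^sub>2') (u\<^sub>1 + u\<^sub>1') (u\<^sub>2 + u\<^sub>2')"
    using assms by (intro splittable_add) (simp_all add: aligned_def)
  with assms show ?thesis
    by (auto simp: aligned_def elim!: splittable_cong)
qed

lemma aligned_commute: "aligned u\<^sub>1 u\<^sub>2 e f\<^sub>1 f\<^sub>2 r \<Longrightarrow> aligned u\<^sub>2 u\<^sub>1 e f\<^sub>2 f\<^sub>1 r"
  using splittable_commute unfolding aligned_def by (simp add: ac_simps)

text \<open>These facts are cited by position: 2 to 4 have \<open>r = 0\<close>, 5 to 8 have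
  \<open>r = 1\<close>, 9 and 10 are the pairs of graphs, and 11 to 13 mix \<open>u\<close>,
  \<open>f\<close> and \<open>e\<close> pieces with \<open>r\<close> at least 2.\<close>

lemma aligned_blocks:
  "aligned 0 0 0 0 0 0" "aligned 1 0 0 0 0 0" "aligned 0 0 0 1 0 0" "aligned 0 0 1 0 0 0"
  "aligned 1 0 0 1 0 1" "aligned 1 0 1 0 0 1" "aligned 0 0 1 1 0 1" "aligned 0 0 2 0 0 1"
  "aligned 0 0 2 0 0 2" "aligned 0 0 3 0 0 3" "aligned 1 0 1 1 0 2" "aligned 1 0 1 0 1 2"
  "aligned 1 0 2 0 1 3"
  using splittable_0 splittable_u splittable_f splittable_e splittable_uf_1 splittable_ue_1
    splittable_ef_1 splittable_ee_1 splittable_ee_2 splittable_eee_3 splittable_ufe_2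
    splittable_u_f_e_2 splittable_u_f_ee_3
  by (simp_all add: aligned_def numeral_eq_Suc)

lemma aligned_0: "aligned u\<^sub>1 u\<^sub>2 e f\<^sub>1 f\<^sub>2 0"
proof -
  have u: "aligned n 0 0 0 0 0" for n
    by (induction n) (use aligned_blocks(1) aligned_add[OF _ aligned_blocks(2)] in fastforce)+
  have f: "aligned 0 0 0 n 0 0" for n
    by (induction n) (use aligned_blocks(1) aligned_add[OF _ aligned_blocks(3)] in fastforce)+
  have e: "aligned 0 0 n 0 0 0" for n
    by (induction n) (use aligned_blocks(1) aligned_add[OF _ aligned_blocks(4)] in fastforce)+
  show ?thesis
    using aligned_add[OF aligned_add[OF aligned_add[OF u f]
        aligned_commute[OF aligned_add[OF u f]]] e]
    by simp
qed

lemma aligned_addI: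
  assumes "aligned v\<^sub>1 v\<^sub>2 d g\<^sub>1 g\<^sub>2 s" "v\<^sub>1 \<le> u\<^sub>1" "v\<^sub>2 \<le> u\<^sub>2" "d \<le> e" "g\<^sub>1 \<le> f\<^sub>1" "g\<^sub>2 \<le> f\<^sub>2" "s \<le> r"
    and "aligned (u\<^sub>1 - v\<^sub>1) (u\<^sub>2 - v\<^sub>2) (e - d) (f\<^sub>1 - g\<^sub>1) (f\<^sub>2 - g\<^sub>2) (r - s)"
  shows "aligned u\<^sub>1 u\<^sub>2 e f\<^sub>1 f\<^sub>2 r"
  using aligned_add[OF assms(1,8)] assms(2-7) by simp

text \<open>The condition on scalars says that the field has two elements. A plane then has only
  three lines; two are \<open>U\<close> and \<open>U'\<close>, and both halves would have to be the
  third.\<close>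

definition unalignable :: "nat \<Rightarrow> nat \<Rightarrow> nat \<Rightarrow> nat \<Rightarrow> nat \<Rightarrow> nat \<Rightarrow> bool" where
  "unalignable u\<^sub>1 u\<^sub>2 e f\<^sub>1 f\<^sub>2 r \<longleftrightarrow> (\<forall>t::'a. t = 0 \<or> t = 1) \<and> (u\<^sub>1, u\<^sub>2, e, f\<^sub>1, f\<^sub>2, r) = (0, 0, 1, 0, 0, 1)"

text \<open>Pairs of \<open>e\<close> planes are split off until \<open>r\<close> is 2 or 3, so that
  \<open>r = 1\<close> is never produced on the way. If \<open>r = 1\<close> at the start, a second
  \<open>e\<close> plane, a neighbouring \<open>u\<close> or \<open>f\<close> line, or a third
  scalar helps.\<close>

lemma aligned_le_e:
  "r \<le> e \<Longrightarrow> \<not> unalignable u\<^sub>1 u\<^sub>2 e f\<^sub>1 f\<^sub>2 r \<Longrightarrow> aligned u\<^sub>1 u\<^sub>2 e f\<^sub>1 f\<^sub>2 r"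
proof (induction r arbitrary: e rule: less_induct)
  case (less r)
  note rest = aligned_0 less.prems(1)
  consider "r = 0" | "r = 1" "e = 1" | "r = 1" "2 \<le> e" | "r = 2" | "r = 3" | "4 \<le> r"
    using less.prems(1) by linarith
  then show ?case
  proof cases
    case 1
    then show ?thesis using aligned_0 by simp
  next
    case 2
    then have "u\<^sub>1 \<ge> 1 \<or> u\<^sub>2 \<ge> 1 \<or> f\<^sub>1 \<ge> 1 \<or> f\<^sub>2 \<ge> 1 \<or> (\<exists>t::'a. t \<noteq> 0 \<and> t \<noteq> 1)"
      using less.prems(2) by (auto simp: unalignable_def)
    then consider "u\<^sub>1 \<ge> 1" | "u\<^sub>2 \<ge> 1" | "f\<^sub>1 \<ge> 1" | "f\<^sub>2 \<ge> 1"
      | t :: 'a where "t \<noteq> 0" "t \<noteq> 1"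
      by blast
    then show ?thesis
    proof cases
      case 1
      show ?thesis
        by (rule aligned_addI[OF aligned_blocks(6)]) (use 1 rest \<open>r = 1\<close> in simp_all)
    next
      case 2
      show ?thesis
        by (rule aligned_addI[OF aligned_commute[OF aligned_blocks(6)]])
          (use 2 rest \<open>r = 1\<close> in simp_all)
    next
      case 3
      show ?thesis
        by (rule aligned_addI[OF aligned_blocks(7)]) (use 3 rest \<open>r = 1\<close> in simp_all)
    next
      case 4
      show ?thesis
        by (rule aligned_addI[OF aligned_commute[OF aligned_blocks(7)]])
          (use 4 rest \<open>r = 1\<close> in simp_all)
    next
      case 5
      then have *: "aligned 0 0 1 0 0 1"
        using splittable_e_1 by (simp add: aligned_def)
      show ?thesis
        by (rule aligned_addI[OF *]) (use rest \<open>r = 1\<close> in simp_all)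
    qed
  next
    case 3
    show ?thesis
      by (rule aligned_addI[OF aligned_blocks(8)]) (use 3 rest in simp_all)
  next
    case 4
    show ?thesis
      by (rule aligned_addI[OF aligned_blocks(9)]) (use 4 rest in simp_all)
  next
    case 5
    show ?thesis
      by (rule aligned_addI[OF aligned_blocks(10)]) (use 5 rest in simp_all)
  next
    case 6
    \<comment> \<open>As \<open>r - 2\<close> is at least 2, the remainder is not
      exceptional.\<close>
    then have *: "aligned u\<^sub>1 u\<^sub>2 (e - 2) f\<^sub>1 f\<^sub>2 (r - 2)"
      using less.IH[of "r - 2" "e - 2"] less.prems(1) by (simp add: unalignable_def)
    show ?thesis
      by (rule aligned_addI[OF aligned_blocks(9)]) (use * less.prems(1) \<open>4 \<le> r\<close> in simp_all)
  qed
qed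

text \<open>The third and fourth inequalities are forced: \<open>U\<close> and \<open>U'\<close>
  meet the first half, of dimension \<open>u\<^sub>1 + e + f\<^sub>1\<close>, in dimension
  \<open>u\<^sub>1\<close> each, and the overlap lies in \<open>U \<inter> U'\<close>, of dimension
  \<open>u\<^sub>1 + u\<^sub>2 + e - r\<close>; likewise for the second half. The induction splits
  off a block that preserves all four inequalities.\<close>

lemma alignedI:
  assumes "r \<le> u\<^sub>1 + u\<^sub>2 + e" "r \<le> e + f\<^sub>1 + f\<^sub>2" "r \<le> u\<^sub>2 + 2 * e + f\<^sub>1" "r \<le> u\<^sub>1 + 2 * e + f\<^sub>2"
    and "\<not> unalignable u\<^sub>1 u\<^sub>2 e f\<^sub>1 f\<^sub>2 r"
  shows "aligned u\<^sub>1 u\<^sub>2 e f\<^sub>1 f\<^sub>2 r"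
  using assms
proof (induction r arbitrary: u\<^sub>1 u\<^sub>2 e f\<^sub>1 f\<^sub>2 rule: less_induct)
  case (less r)
  \<comment> \<open>The parameters are generalized so that the claim also serves with the two halves
    exchanged.\<close>
  have uf: "aligned u\<^sub>1 u\<^sub>2 e f\<^sub>1 f\<^sub>2 r"
    if "u\<^sub>1 \<ge> 1" "f\<^sub>1 \<ge> 1" "e < r" "r \<le> u\<^sub>1 + u\<^sub>2 + e" "r \<le> e + f\<^sub>1 + f\<^sub>2"
      "r \<le> u\<^sub>2 + 2 * e + f\<^sub>1" "r \<le> u\<^sub>1 + 2 * e + f\<^sub>2" for u\<^sub>1 u\<^sub>2 f\<^sub>1 f\<^sub>2
  proof (cases "unalignable (u\<^sub>1 - 1) u\<^sub>2 e (f\<^sub>1 - 1) f\<^sub>2 (r - 1)")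
    case True
    \<comment> \<open>Splitting off would leave the exceptional plane, so everything is one larger
      block.\<close>
    then have "u\<^sub>1 = 1" "u\<^sub>2 = 0" "e = 1" "f\<^sub>1 = 1" "f\<^sub>2 = 0" "r = 2"
      using that by (auto simp: unalignable_def)
    then show ?thesis
      using aligned_blocks(11) by simp
  next
    case False
    show ?thesis
      by (rule aligned_addI[OF aligned_blocks(5)])
        (use False less.IH[of "r - 1" "u\<^sub>1 - 1" u\<^sub>2 e "f\<^sub>1 - 1" f\<^sub>2] that in simp_all)
  qed
  \<comment> \<open>With \<open>u\<^sub>2 = f\<^sub>1 = 0\<close> the third inequality reads
    \<open>r \<le> 2 * e\<close>, so together with \<open>e < r\<close> there is an \<open>e\<close>
    plane to spend and \<open>r\<close> is at least 2.\<close>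
  have u_f: "aligned u\<^sub>1 u\<^sub>2 e f\<^sub>1 f\<^sub>2 r"
    if "u\<^sub>1 \<ge> 1" "f\<^sub>2 \<ge> 1" "u\<^sub>2 = 0" "f\<^sub>1 = 0" "e < r" "r \<le> u\<^sub>1 + u\<^sub>2 + e" "r \<le> e + f\<^sub>1 + f\<^sub>2"
      "r \<le> u\<^sub>2 + 2 * e + f\<^sub>1" "r \<le> u\<^sub>1 + 2 * e + f\<^sub>2" for u\<^sub>1 u\<^sub>2 f\<^sub>1 f\<^sub>2
  proof (cases "unalignable (u\<^sub>1 - 1) u\<^sub>2 (e - 1) f\<^sub>1 (f\<^sub>2 - 1) (r - 2)")
    case True
    then have "u\<^sub>1 = 1" "u\<^sub>2 = 0" "e = 2" "f\<^sub>1 = 0" "f\<^sub>2 = 1" "r = 3"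
      using that by (auto simp: unalignable_def)
    then show ?thesis
      using aligned_blocks(13) by simp
  next
    case False
    show ?thesis
      by (rule aligned_addI[OF aligned_blocks(12)])
        (use False less.IH[of "r - 2" "u\<^sub>1 - 1" u\<^sub>2 "e - 1" f\<^sub>1 "f\<^sub>2 - 1"] that in simp_all)
  qed
  show ?case
  proof (cases "r \<le> e")
    case True
    then show ?thesis using aligned_le_e less.prems(5) by blast
  next
    case False
    \<comment> \<open>Since \<open>r\<close> exceeds \<open>e\<close>, the first two inequalities
      yield at least one \<open>u\<close> and one \<open>f\<close>; the last two cases arise when no
      half has both.\<close>
    then consider "u\<^sub>1 \<ge> 1" "f\<^sub>1 \<ge> 1" | "u\<^sub>2 \<ge> 1" "f\<^sub>2 \<ge> 1"
      | "u\<^sub>1 \<ge> 1" "f\<^sub>2 \<ge> 1" "u\<^sub>2 = 0" "f\<^sub>1 = 0" | "u\<^sub>2 \<ge> 1" "f\<^sub>1 \<ge> 1" "u\<^sub>1 = 0" "f\<^sub>2 = 0"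
      using less.prems(1,2) by linarith
    then show ?thesis
    proof cases
      case 1
      then show ?thesis using uf less.prems(1-4) False by simp
    next
      case 2
      show ?thesis
        by (rule aligned_commute, rule uf) (use 2 less.prems(1-4) False in simp_all)
    next
      case 3
      then show ?thesis using u_f less.prems(1-4) False by simp
    next
      case 4
      show ?thesis
        by (rule aligned_commute, rule u_f) (use 4 less.prems(1-4) False in simp_all)
    qed
  qed
qed

text \<open>The required dimensions determine the numbers of pieces. Of the inequalities of
  \<open>alignedI\<close>, the first two become the bounds on \<open>i\<close>, and the other two
  follow from \<open>2 * k\<^sub>2 \<le> k + i\<close>.\<close>

lemma splittable_aligned:
  assumes "m \<le> k + k\<^sub>1" "k\<^sub>1 + k\<^sub>2 \<le> m" "k\<^sub>1 \<le> k\<^sub>2" "k\<^sub>2 \<le> k" "i \<le> m" "2 * m \<le> 2 * k + i"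
    and "2 * k\<^sub>2 \<le> k + i"
    and "\<not> ((\<forall>t::'a. t = 0 \<or> t = 1) \<and> m = 1 \<and> k = 1 \<and> k\<^sub>1 = 0 \<and> k\<^sub>2 = 0 \<and> i = 0)"
  shows "splittable i (m - i) (2 * k + i - 2 * m) k k k\<^sub>1 k\<^sub>2 k\<^sub>1 k\<^sub>2"
proof -
  have "aligned k\<^sub>1 k\<^sub>2 (m - k\<^sub>1 - k\<^sub>2) (k + k\<^sub>2 - m) (k + k\<^sub>1 - m) (m - i)"
    by (rule alignedI) (use assms in \<open>auto simp: unalignable_def\<close>)
  then show ?thesis
    unfolding aligned_def by (elim conjE splittable_cong) (use assms in simp_all)
qed

section \<open>Bisections meeting the two subspaces in opposite order\<close>

lemma splittable_swaps: "splittable 0 n 0 n n 0 n n 0"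
  by (induction n) (use splittable_0 splittable_add[OF splittable_swap] in fastforce)+

text \<open>Splitting off \<open>k\<^sub>2 - k\<^sub>1\<close> swap planes leaves an aligned problem
  with all four intersections of dimension \<open>k\<^sub>1\<close>, whose inequalities hold under
  the assumptions. If it is the exceptional plane, one swap is merged with it.\<close>

lemma splittable_opposite:
  assumes "m \<le> k + k\<^sub>1" "k\<^sub>1 + k\<^sub>2 \<le> m" "k\<^sub>1 < k\<^sub>2" "k\<^sub>2 \<le> k" "2 * m \<le> 2 * k + i"
    and "i + k\<^sub>2 \<le> m + k\<^sub>1"
  shows "splittable i (m - i) (2 * k + i - 2 * m) k k k\<^sub>1 k\<^sub>2 k\<^sub>2 k\<^sub>1"
proof (cases "unalignable k\<^sub>1 k\<^sub>1 (m - k\<^sub>1 - k\<^sub>2) (k + k\<^sub>1 - m) (k + k\<^sub>1 - m) (m - i - (k\<^sub>2 - k\<^sub>1))")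
  case True
  then have "k\<^sub>1 = 0" "m = k\<^sub>2 + 1" "k = k\<^sub>2 + 1" "i = 0"
    using assms by (auto simp: unalignable_def)
  then show ?thesis
    using splittable_add[OF splittable_swap_e splittable_swaps[of "k\<^sub>2 - 1"]] assms(3)
    by (elim splittable_cong) simp_all
next
  case False
  then have "aligned k\<^sub>1 k\<^sub>1 (m - k\<^sub>1 - k\<^sub>2) (k + k\<^sub>1 - m) (k + k\<^sub>1 - m) (m - i - (k\<^sub>2 - k\<^sub>1))"
    by (rule alignedI[rotated -1]) (use assms in simp_all)
  then have "splittable (k\<^sub>1 + k\<^sub>1 + (m - k\<^sub>1 - k\<^sub>2) - (m - i - (k\<^sub>2 - k\<^sub>1))) (m - i - (k\<^sub>2 - k\<^sub>1))
      (m - k\<^sub>1 - k\<^sub>2 + (k + k\<^sub>1 - m) + (k + k\<^sub>1 - m) - (m - i - (k\<^sub>2 - k\<^sub>1)))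
      (k\<^sub>1 + (m - k\<^sub>1 - k\<^sub>2) + (k + k\<^sub>1 - m)) (k\<^sub>1 + (m - k\<^sub>1 - k\<^sub>2) + (k + k\<^sub>1 - m)) k\<^sub>1 k\<^sub>1 k\<^sub>1 k\<^sub>1"
    unfolding aligned_def by blast
  from splittable_add[OF splittable_swaps[of "k\<^sub>2 - k\<^sub>1"] this] show ?thesis
    by (rule splittable_cong) (use assms in simp_all)
qed

section \<open>Bases adapted to two subspaces\<close>

text \<open>The dimension formula gives the span of the union dimension
  \<open>card W + card A + card B\<close>, which leaves room neither for a dependence nor for an
  overlap of \<open>A\<close> and \<open>B\<close>.\<close>

lemma independent_span_Un_bases:
  assumes "independent W" "independent (W \<union> A)" "independent (W \<union> B)" "W \<inter> A = {}" "W \<inter> B = {}"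
    and "span W = span (W \<union> A) \<inter> span (W \<union> B)"
  shows "independent (W \<union> A \<union> B)" "A \<inter> B = {}"
proof -
  have fin: "finite W" "finite A" "finite B"
    using assms finiteI_independent by (auto dest: finiteI_independent)
  have "dim (span (span (W \<union> A) \<union> span (W \<union> B))) + dim (span W) =
      dim (span (W \<union> A)) + dim (span (W \<union> B))"
    using dim_sums_Int[OF subspace_span subspace_span, of "W \<union> A" "W \<union> B"] assms(6)
    unfolding span_Un_subspaces[OF subspace_span subspace_span, symmetric] by simp
  moreover have "span (span (W \<union> A) \<union> span (W \<union> B)) = span (W \<union> A \<union> B)"
    unfolding span_span_Un by (rule arg_cong[where f = span]) auto
  ultimately have "dim (W \<union> A \<union> B) = card W + card A + card B"
    using assms(4,5) card_Un_disjoint[OF fin(1,2)] card_Un_disjoint[OF fin(1,3)]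
      dim_span_eq_card_independent[OF assms(1)] dim_span_eq_card_independent[OF assms(2)]
      dim_span_eq_card_independent[OF assms(3)]
    by simp
  moreover have "dim (W \<union> A \<union> B) \<le> card (W \<union> A \<union> B)"
    using fin by (intro dim_le_card) (auto simp: span_superset)
  moreover have "card (W \<union> A \<union> B) \<le> card W + card (A \<union> B)"
    by (metis Un_assoc card_Un_le)
  moreover have "card (A \<union> B) + card (A \<inter> B) = card A + card B"
    using card_Un_Int[OF fin(2,3)] by simp
  ultimately have c: "card (W \<union> A \<union> B) = dim (W \<union> A \<union> B)" "card (A \<inter> B) = 0"
    by linarith+
  show "independent (W \<union> A \<union> B)"
    by (rule card_le_dim_spanning[of _ "span (W \<union> A \<union> B)"]) (use fin c in \<open>auto simp: span_superset\<close>)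
  show "A \<inter> B = {}"
    using c fin by simp
qed

lemma exists_frame:
  assumes "subspace U" "subspace U'"
  obtains ws as bs cs where "frame ws as bs cs" "span (set (ws @ as)) = U" "span (set (ws @ bs)) = U'"
    "span (set (ws @ as @ bs @ cs)) = UNIV" "length ws = dim (U \<inter> U')"
    "length ws + length as = dim U" "length ws + length bs = dim U'"
    "length ws + length as + length bs + length cs = dim (UNIV :: 'b set)"
proof -
  obtain W where W: "W \<subseteq> U \<inter> U'" "independent W" "U \<inter> U' \<subseteq> span W"
    using maximal_independent_subset[of "U \<inter> U'"] by metis
  obtain P where P: "W \<subseteq> P" "P \<subseteq> U" "independent P" "U \<subseteq> span P"
    using maximal_independent_subset_extend[of W U] W(1,2) by (metis le_inf_iff)
  obtain Q where Q: "W \<subseteq> Q" "Q \<subseteq> U'" "independent Q" "U' \<subseteq> span Q"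
    using maximal_independent_subset_extend[of W U'] W(1,2) by (metis le_inf_iff)
  define A B where "A = P - W" and "B = Q - W"
  have AB: "P = W \<union> A" "W \<inter> A = {}" "Q = W \<union> B" "W \<inter> B = {}"
    using P Q by (auto simp: A_def B_def)
  have sp: "span W = U \<inter> U'" "span (W \<union> A) = U" "span (W \<union> B) = U'"
    unfolding AB[symmetric]
    by (rule span_subspace[OF W(1,3) subspace_inter[OF assms]],
        rule span_subspace[OF P(2,4) assms(1)], rule span_subspace[OF Q(2,4) assms(2)])
  have ind: "independent (W \<union> A \<union> B)" "A \<inter> B = {}"
    using independent_span_Un_bases[of W A B] W P Q AB sp by auto
  obtain R where R: "W \<union> A \<union> B \<subseteq> R" "independent R" "UNIV \<subseteq> span R"
    using maximal_independent_subset_extend[OF subset_UNIV ind(1)] by metis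
  define C where "C = R - (W \<union> A \<union> B)"
  have C: "R = W \<union> A \<union> B \<union> C" "(W \<union> A \<union> B) \<inter> C = {}"
    using R by (auto simp: C_def)
  have "finite R"
    using R(2) by (rule finiteI_independent)
  then have fin: "finite W" "finite A" "finite B" "finite C"
    unfolding C(1) by simp_all
  obtain ws as bs cs where l: "set ws = W" "distinct ws" "set as = A" "distinct as"
    "set bs = B" "distinct bs" "set cs = C" "distinct cs"
    using finite_distinct_list[OF fin(1)] finite_distinct_list[OF fin(2)]
      finite_distinct_list[OF fin(3)] finite_distinct_list[OF fin(4)] by blast
  have sets: "set (ws @ as) = P" "set (ws @ bs) = Q" "set (ws @ as @ bs @ cs) = R"
    by (simp_all add: l AB C(1) Un_assoc)
  have dist: "distinct (ws @ as @ bs @ cs)"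
    using l AB(2,4) C(2) ind(2) by (simp add: Int_Un_distrib Int_Un_distrib2)
  have len: "length xs = dim (span (set xs))" if "distinct xs" "independent (set xs)" for xs
    using dim_span_eq_card_independent[OF that(2)] distinct_card[OF that(1)] by linarith
  have "frame ws as bs cs"
    using dist R(2) unfolding frame_def sets by blast
  moreover have "length ws = dim (U \<inter> U')"
    using len[of ws] l W sp by simp
  moreover have "length ws + length as = dim U"
    using len[of "ws @ as"] dist P(3) sp(2) unfolding sets AB[symmetric] by auto
  moreover have "length ws + length bs = dim U'"
    using len[of "ws @ bs"] dist Q(3) sp(3) unfolding sets AB[symmetric] by auto
  moreover have "span R = UNIV"
    using R(3) by blast
  moreover from this have "length ws + length as + length bs + length cs = dim (UNIV :: 'b set)"
    using len[OF dist] R(2) unfolding sets by simp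
  ultimately show thesis
    using that[of ws as bs cs] sp(2,3) unfolding sets AB[symmetric] by blast
qed

section \<open>Bisections, incidence and admissibility\<close>

lemma direct_sum_decomposition_iff:
  assumes "subspace V\<^sub>1" "subspace V\<^sub>2" "dim V\<^sub>1 + dim V\<^sub>2 = dim (UNIV :: 'b set)"
  shows "direct_sum_decomposition V\<^sub>1 V\<^sub>2 \<longleftrightarrow> span (V\<^sub>1 \<union> V\<^sub>2) = UNIV"
proof -
  have "V\<^sub>1 \<inter> V\<^sub>2 = {0}" if "span (V\<^sub>1 \<union> V\<^sub>2) = UNIV"
  proof -
    have "dim (V\<^sub>1 \<inter> V\<^sub>2) = 0"
      using dim_sums_Int[OF assms(1,2)] assms(3) that
      unfolding span_Un_subspaces[OF assms(1,2), symmetric] by simp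
    then show ?thesis
      using assms subspace_0 by (auto simp: dim_eq_0)
  qed
  then show ?thesis
    using assms by (auto simp: direct_sum_decomposition_def span_Un_subspaces)
qed

lemma dim_Int_ge:
  assumes "subspace X" "subspace Y" "X \<subseteq> S" "Y \<subseteq> S" "subspace S"
  shows "dim X + dim Y \<le> dim S + dim (X \<inter> Y)"
proof -
  have "span (X \<union> Y) \<subseteq> S"
    using assms by (intro span_minimal) auto
  then have "dim (span (X \<union> Y)) \<le> dim S"
    by (rule dim_subset)
  then show ?thesis
    using dim_sums_Int[OF assms(1,2)] unfolding span_Un_subspaces[OF assms(1,2)] by linarith
qed

text \<open>A line is an unordered pair, so its halves can be renamed to absorb the second
  alternative of incidence.\<close>

lemma incident_iff:
  assumes "L \<in> bisections k"
  shows "incident (subspace_bisection_geometry m k k\<^sub>1 k\<^sub>2) U L \<longleftrightarrow>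
    (\<exists>V\<^sub>1 V\<^sub>2. L = {V\<^sub>1, V\<^sub>2} \<and> direct_sum_decomposition V\<^sub>1 V\<^sub>2 \<and> dim V\<^sub>1 = k \<and> dim V\<^sub>2 = k \<and>
       dim (U \<inter> V\<^sub>1) = k\<^sub>1 \<and> dim (U \<inter> V\<^sub>2) = k\<^sub>2)"
proof -
  have comm: "direct_sum_decomposition V\<^sub>2 V\<^sub>1" if "direct_sum_decomposition V\<^sub>1 V\<^sub>2" for V\<^sub>1 V\<^sub>2
  proof -
    have "{x + y | x y. x \<in> V\<^sub>1 \<and> y \<in> V\<^sub>2} = {x + y | x y. x \<in> V\<^sub>2 \<and> y \<in> V\<^sub>1}"
      using add.commute by blast
    with that show ?thesis
      by (simp add: direct_sum_decomposition_def Int_commute)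
  qed
  obtain W\<^sub>1 W\<^sub>2 where W: "L = {W\<^sub>1, W\<^sub>2}" "direct_sum_decomposition W\<^sub>1 W\<^sub>2" "dim W\<^sub>1 = k" "dim W\<^sub>2 = k"
    using assms by (auto simp: bisections_def)
  show ?thesis
    unfolding subspace_bisection_geometry_def using W comm[OF W(2)]
    by (auto simp: doubleton_eq_iff; metis)
qed

lemma admissible_bounds:
  assumes "admissible m k k\<^sub>1 k\<^sub>2" and V: "dim (UNIV :: 'b set) = 2 * k"
  shows "k\<^sub>1 \<le> k\<^sub>2" "m \<le> k + k\<^sub>1" "k\<^sub>1 + k\<^sub>2 \<le> m" "k\<^sub>2 \<le> k"
proof -
  show "k\<^sub>1 \<le> k\<^sub>2"
    using assms by (simp add: admissible_def)
  obtain U L where U: "subspace U" "dim U = m" and L: "L \<in> bisections k"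
    and inc: "incident (subspace_bisection_geometry m k k\<^sub>1 k\<^sub>2) U L"
    using assms(1) by (auto simp: admissible_def subspace_bisection_geometry_def)
  then obtain V\<^sub>1 V\<^sub>2 where D: "direct_sum_decomposition V\<^sub>1 V\<^sub>2" and d: "dim V\<^sub>1 = k" "dim V\<^sub>2 = k"
    "dim (U \<inter> V\<^sub>1) = k\<^sub>1" "dim (U \<inter> V\<^sub>2) = k\<^sub>2"
    unfolding incident_iff[OF L] by blast
  have sub: "subspace V\<^sub>1" "subspace V\<^sub>2" and zero: "V\<^sub>1 \<inter> V\<^sub>2 = {0}"
    using D by (auto simp: direct_sum_decomposition_def)
  show "m \<le> k + k\<^sub>1"
    using dim_Int_ge[of U V\<^sub>1 UNIV] U sub d V by simp
  have "(U \<inter> V\<^sub>1) \<inter> (U \<inter> V\<^sub>2) \<subseteq> {0}"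
    using zero by blast
  then have "dim ((U \<inter> V\<^sub>1) \<inter> (U \<inter> V\<^sub>2)) = 0"
    unfolding dim_eq_0 .
  moreover have "k\<^sub>1 + k\<^sub>2 \<le> m + dim ((U \<inter> V\<^sub>1) \<inter> (U \<inter> V\<^sub>2))"
    using dim_Int_ge[of "U \<inter> V\<^sub>1" "U \<inter> V\<^sub>2" U] U sub d by (simp add: subspace_inter)
  ultimately show "k\<^sub>1 + k\<^sub>2 \<le> m"
    by linarith
  show "k\<^sub>2 \<le> k"
    using dim_subset[of "U \<inter> V\<^sub>2" V\<^sub>2] d by simp
qed

section \<open>Existence of common lines\<close>

text \<open>This transfers the numerical statements to the geometry: a frame adapted to
  \<open>U\<close> and \<open>U'\<close> has \<open>2 * k + i - 2 * m\<close> vectors outside their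
  sum, and a bisection of it is a line through both.\<close>

lemma splittable_imp_common_line:
  assumes V: "dim (UNIV :: 'b set) = 2 * k"
    and U: "subspace U" "dim U = m" and U': "subspace U'" "dim U' = m"
    and spl: "splittable i (m - i) (2 * k + i - 2 * m) k k k\<^sub>1 k\<^sub>2 y\<^sub>1 y\<^sub>2" "i = dim (U \<inter> U')"
    and y: "(y\<^sub>1, y\<^sub>2) = (k\<^sub>1, k\<^sub>2) \<or> (y\<^sub>1, y\<^sub>2) = (k\<^sub>2, k\<^sub>1)"
  shows "\<exists>L \<in> lines (subspace_bisection_geometry m k k\<^sub>1 k\<^sub>2).
    incident (subspace_bisection_geometry m k k\<^sub>1 k\<^sub>2) U L \<and>
    incident (subspace_bisection_geometry m k k\<^sub>1 k\<^sub>2) U' L"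
proof -
  obtain ws as bs cs where fr: "frame ws as bs cs" "span (set (ws @ as)) = U"
    "span (set (ws @ bs)) = U'" "span (set (ws @ as @ bs @ cs)) = UNIV"
    and len: "length ws = dim (U \<inter> U')" "length ws + length as = dim U"
      "length ws + length bs = dim U'"
      "length ws + length as + length bs + length cs = dim (UNIV :: 'b set)"
    using exists_frame[OF U(1) U'(1)] by metis
  have "length ws = i" "length as = m - i" "length bs = m - i" "length cs = 2 * k + i - 2 * m"
    using len spl(2) V U(2) U'(2) by linarith+
  then obtain V\<^sub>1 V\<^sub>2 where "splits ws as bs cs V\<^sub>1 V\<^sub>2 k k k\<^sub>1 k\<^sub>2 y\<^sub>1 y\<^sub>2"
    using spl(1) fr(1) unfolding splittable_def by blast
  then have S: "subspace V\<^sub>1" "subspace V\<^sub>2" "span (V\<^sub>1 \<union> V\<^sub>2) = UNIV" "dim V\<^sub>1 = k" "dim V\<^sub>2 = k"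
    and I: "dim (U \<inter> V\<^sub>1) = k\<^sub>1" "dim (U \<inter> V\<^sub>2) = k\<^sub>2" "dim (U' \<inter> V\<^sub>1) = y\<^sub>1" "dim (U' \<inter> V\<^sub>2) = y\<^sub>2"
    unfolding splits_def fr by auto
  have "direct_sum_decomposition V\<^sub>1 V\<^sub>2"
    using direct_sum_decomposition_iff[OF S(1,2)] S V by simp
  then have "{V\<^sub>1, V\<^sub>2} \<in> bisections k"
    using S by (auto simp: bisections_def)
  then show ?thesis
    using I y unfolding subspace_bisection_geometry_def by auto
qed

lemma collinearly_completeI:
  assumes V: "dim (UNIV :: 'b set) = 2 * k"
    and adm: "m \<le> k + k\<^sub>1" "k\<^sub>1 + k\<^sub>2 \<le> m" "k\<^sub>1 \<le> k\<^sub>2" "k\<^sub>2 \<le> k"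
    and bound: "3 * k\<^sub>2 \<le> k + 1 + m + k\<^sub>1"
    and exc: "\<not> ((\<forall>t::'a. t = 0 \<or> t = 1) \<and> m = 1 \<and> k = 1 \<and> k\<^sub>1 = 0 \<and> k\<^sub>2 = 0)"
  shows "collinearly_complete (subspace_bisection_geometry m k k\<^sub>1 k\<^sub>2)"
  unfolding collinearly_complete_def
proof (intro ballI impI)
  fix U U' assume "U \<in> points (subspace_bisection_geometry m k k\<^sub>1 k\<^sub>2)"
    "U' \<in> points (subspace_bisection_geometry m k k\<^sub>1 k\<^sub>2)" and ne: "U \<noteq> U'"
  then have U: "subspace U" "dim U = m" and U': "subspace U'" "dim U' = m"
    by (auto simp: subspace_bisection_geometry_def)
  define i where "i = dim (U \<inter> U')"
  have i: "i \<le> m" "2 * m \<le> 2 * k + i"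
    using dim_subset[of "U \<inter> U'" U] dim_Int_ge[of U U' UNIV] U U' V by (auto simp: i_def)
  show "\<exists>L \<in> lines (subspace_bisection_geometry m k k\<^sub>1 k\<^sub>2).
    incident (subspace_bisection_geometry m k k\<^sub>1 k\<^sub>2) U L \<and>
    incident (subspace_bisection_geometry m k k\<^sub>1 k\<^sub>2) U' L"
  proof (cases "k\<^sub>1 < k\<^sub>2 \<and> i + k\<^sub>2 \<le> m + k\<^sub>1")
    case True
    then have "splittable i (m - i) (2 * k + i - 2 * m) k k k\<^sub>1 k\<^sub>2 k\<^sub>2 k\<^sub>1"
      using splittable_opposite adm i by blast
    then show ?thesis
      using splittable_imp_common_line[OF V U U'] i_def by blast
  next
    case False
    \<comment> \<open>If \<open>k\<^sub>1 < k\<^sub>2\<close>, then \<open>i\<close> is at least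
      \<open>m + k\<^sub>1 - k\<^sub>2 + 1\<close>, and the 1 here matches the one in
      \<open>bound\<close>. If \<open>k\<^sub>1 = k\<^sub>2\<close>, the bounds
      \<open>k\<^sub>1 + k\<^sub>2 \<le> m\<close> and \<open>2 * m \<le> 2 * k + i\<close>
      suffice.\<close>
    then have "2 * k\<^sub>2 \<le> k + i"
      using adm i bound by linarith
    then have "splittable i (m - i) (2 * k + i - 2 * m) k k k\<^sub>1 k\<^sub>2 k\<^sub>1 k\<^sub>2"
      using splittable_aligned adm i exc by blast
    then show ?thesis
      using splittable_imp_common_line[OF V U U'] i_def by blast
  qed
qed

section \<open>Necessity of the inequality\<close>

text \<open>Two sets of \<open>m\<close> vectors of a fixed basis with exactly \<open>i\<close> in
  common span such a pair; the second assumption says that the basis is large enough.\<close>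

lemma exists_subspace_pair:
  assumes "i \<le> m" "2 * m \<le> dim (UNIV :: 'b set) + i"
  obtains U U' where "subspace U" "dim U = m" "subspace U'" "dim U' = m" "dim (U \<inter> U') = i"
proof -
  have "2 * m - i \<le> card Basis"
    using assms(2) by simp
  then obtain P where P: "P \<subseteq> Basis" "card P = 2 * m - i" and fin: "finite P"
    by (rule obtain_subset_with_card_n)
  have "i \<le> card P"
    using P(2) assms(1) by simp
  then obtain W where W: "W \<subseteq> P" "card W = i" "finite W"
    by (rule obtain_subset_with_card_n)
  have cPW: "card (P - W) = (m - i) + (m - i)"
    using card_Diff_subset[OF W(3,1)] W P assms(1) by simp
  then have "m - i \<le> card (P - W)"
    by simp
  then obtain A where A: "A \<subseteq> P - W" "card A = m - i" "finite A"
    by (rule obtain_subset_with_card_n)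
  define B where "B = P - W - A"
  have B: "card B = m - i" "B \<subseteq> P - W"
    using card_Diff_subset[OF A(3,1)] A(2) cPW by (auto simp: B_def)
  have fins: "finite W" "finite A" "finite B"
    using W(3) A(3) fin by (simp_all add: B_def)
  have un: "W \<union> A \<union> (W \<union> B) = P"
    using W A by (auto simp: B_def)
  have "W \<union> A \<subseteq> Basis" "W \<union> B \<subseteq> Basis"
    using P(1) W(1) A(1) B(2) by auto
  then have ind: "independent P" "independent (W \<union> A)" "independent (W \<union> B)"
    using P(1) independent_mono[OF independent_Basis] by metis+
  have "W \<inter> A = {}" "W \<inter> B = {}"
    using A(1) B(2) by auto
  then have "card (W \<union> A) = m" "card (W \<union> B) = m"
    using card_Un_disjoint[OF fins(1,2)] card_Un_disjoint[OF fins(1,3)] W(2) A(2) B(1) assms(1)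
    by simp_all
  then have d: "dim (span (W \<union> A)) = m" "dim (span (W \<union> B)) = m" "dim (span P) = 2 * m - i"
    using dim_span_eq_card_independent[OF ind(1)] dim_span_eq_card_independent[OF ind(2)]
      dim_span_eq_card_independent[OF ind(3)] P(2) by linarith+
  have "dim (span P) + dim (span (W \<union> A) \<inter> span (W \<union> B)) = m + m"
    using dim_sums_Int[OF subspace_span subspace_span, of "W \<union> A" "W \<union> B"]
    unfolding span_Un_subspaces[OF subspace_span subspace_span, symmetric] span_span_Un un d .
  then have "dim (span (W \<union> A) \<inter> span (W \<union> B)) = i"
    using d(3) assms by linarith
  then show thesis
    using that[OF subspace_span d(1) subspace_span d(2)] by blast
qed

lemma common_lineE:
  assumes "collinearly_complete (subspace_bisection_geometry m k k\<^sub>1 k\<^sub>2)"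
    and "subspace U" "dim U = m" "subspace U'" "dim U' = m" "U \<noteq> U'"
  obtains V\<^sub>1 V\<^sub>2 where "direct_sum_decomposition V\<^sub>1 V\<^sub>2" "dim V\<^sub>1 = k" "dim V\<^sub>2 = k"
    "dim (U \<inter> V\<^sub>1) = k\<^sub>1" "dim (U \<inter> V\<^sub>2) = k\<^sub>2"
    "(dim (U' \<inter> V\<^sub>1), dim (U' \<inter> V\<^sub>2)) \<in> {(k\<^sub>1, k\<^sub>2), (k\<^sub>2, k\<^sub>1)}"
proof -
  have "\<exists>L \<in> lines (subspace_bisection_geometry m k k\<^sub>1 k\<^sub>2).
      incident (subspace_bisection_geometry m k k\<^sub>1 k\<^sub>2) U L \<and>
      incident (subspace_bisection_geometry m k k\<^sub>1 k\<^sub>2) U' L"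
    using assms unfolding collinearly_complete_def by (simp add: subspace_bisection_geometry_def)
  then obtain L where L: "L \<in> bisections k"
    and inc: "incident (subspace_bisection_geometry m k k\<^sub>1 k\<^sub>2) U L"
      "incident (subspace_bisection_geometry m k k\<^sub>1 k\<^sub>2) U' L"
    by (auto simp: subspace_bisection_geometry_def)
  obtain V\<^sub>1 V\<^sub>2 where V: "L = {V\<^sub>1, V\<^sub>2}" "direct_sum_decomposition V\<^sub>1 V\<^sub>2" "dim V\<^sub>1 = k" "dim V\<^sub>2 = k"
    "dim (U \<inter> V\<^sub>1) = k\<^sub>1" "dim (U \<inter> V\<^sub>2) = k\<^sub>2"
    using inc(1) unfolding incident_iff[OF L] by blast
  obtain W\<^sub>1 W\<^sub>2 where W: "L = {W\<^sub>1, W\<^sub>2}" "dim (U' \<inter> W\<^sub>1) = k\<^sub>1" "dim (U' \<inter> W\<^sub>2) = k\<^sub>2"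
    using inc(2) unfolding incident_iff[OF L] by blast
  have "(V\<^sub>1 = W\<^sub>1 \<and> V\<^sub>2 = W\<^sub>2) \<or> (V\<^sub>1 = W\<^sub>2 \<and> V\<^sub>2 = W\<^sub>1)"
    using V(1) W(1) by (auto simp: doubleton_eq_iff)
  then show thesis
    using that[OF V(2-6)] W by auto
qed

lemma not_collinearly_complete:
  assumes V: "dim (UNIV :: 'b set) = 2 * k"
    and adm: "m \<le> k + k\<^sub>1" "k\<^sub>1 + k\<^sub>2 \<le> m" "k\<^sub>2 \<le> k"
    and bound: "k + 1 + m + k\<^sub>1 < 3 * k\<^sub>2"
  shows "\<not> collinearly_complete (subspace_bisection_geometry m k k\<^sub>1 k\<^sub>2)"
proof
  assume cc: "collinearly_complete (subspace_bisection_geometry m k k\<^sub>1 k\<^sub>2)"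
  \<comment> \<open>This is the least dimension of \<open>U \<inter> U'\<close> that excludes the
    opposite order; failure of the inequality says that it also excludes the same order.\<close>
  define i where "i = m + k\<^sub>1 + 1 - k\<^sub>2"
  have i: "i < m" "2 * m \<le> 2 * k + i" "k + i < 2 * k\<^sub>2" "m + k\<^sub>1 < k\<^sub>2 + i"
    using adm bound by (auto simp: i_def)
  obtain U U' where U: "subspace U" "dim U = m" and U': "subspace U'" "dim U' = m"
    and UU': "dim (U \<inter> U') = i"
    using exists_subspace_pair[of i m] i V by auto
  have "U \<noteq> U'"
    using UU' U i(1) by auto
  then obtain V\<^sub>1 V\<^sub>2 where D: "direct_sum_decomposition V\<^sub>1 V\<^sub>2" and d: "dim V\<^sub>1 = k" "dim V\<^sub>2 = k"
    "dim (U \<inter> V\<^sub>1) = k\<^sub>1" "dim (U \<inter> V\<^sub>2) = k\<^sub>2"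
    "(dim (U' \<inter> V\<^sub>1), dim (U' \<inter> V\<^sub>2)) \<in> {(k\<^sub>1, k\<^sub>2), (k\<^sub>2, k\<^sub>1)}"
    using common_lineE[OF cc U U'] by metis
  have sub: "subspace V\<^sub>2"
    using D by (simp add: direct_sum_decomposition_def)
  from d(5) consider "dim (U' \<inter> V\<^sub>2) = k\<^sub>2" | "dim (U' \<inter> V\<^sub>2) = k\<^sub>1"
    by auto
  then show False
  proof cases
    case 1
    have "dim (U \<inter> V\<^sub>2) + dim (U' \<inter> V\<^sub>2) \<le> dim V\<^sub>2 + dim (U \<inter> V\<^sub>2 \<inter> (U' \<inter> V\<^sub>2))"
      by (rule dim_Int_ge) (use U U' sub in \<open>auto simp: subspace_inter\<close>)
    moreover have "dim (U \<inter> V\<^sub>2 \<inter> (U' \<inter> V\<^sub>2)) \<le> dim (U \<inter> U')"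
      by (rule dim_subset) auto
    ultimately show False
      using 1 d UU' i by linarith
  next
    case 2
    \<comment> \<open>Inside \<open>U\<close>, the subspaces \<open>U \<inter> V\<^sub>2\<close> and
      \<open>U \<inter> U'\<close> overlap within \<open>U' \<inter> V\<^sub>2\<close>, whose
      dimension is only \<open>k\<^sub>1\<close>.\<close>
    have "dim (U \<inter> V\<^sub>2) + dim (U \<inter> U') \<le> dim U + dim (U \<inter> V\<^sub>2 \<inter> (U \<inter> U'))"
      by (rule dim_Int_ge) (use U U' sub in \<open>auto simp: subspace_inter\<close>)
    moreover have "dim (U \<inter> V\<^sub>2 \<inter> (U \<inter> U')) \<le> dim (U' \<inter> V\<^sub>2)"
      by (rule dim_subset) auto
    ultimately show False
      using 2 d U UU' i by linarith
  qed
qed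

section \<open>The exceptional plane over the field with two elements\<close>

lemma one_dim_eq_doubleton:
  assumes two: "\<forall>t::'a. t = 0 \<or> t = 1" and X: "subspace X" "dim X = 1"
  obtains a where "a \<noteq> 0" "X = {0, a}"
proof -
  obtain B where B: "B \<subseteq> X" "independent B" "X \<subseteq> span B" "card B = 1"
    using basis_exists[of X] X(2) by metis
  then obtain a where a: "B = {a}"
    using card_1_singletonE by blast
  have "X = span {a}"
    using B X(1) span_subspace a by metis
  also have "\<dots> = {0, a}"
    using two by (auto simp: span_singleton intro: rev_image_eqI[of 0] rev_image_eqI[of 1])
  finally show thesis
    using that B(2) a by auto
qed

lemma not_collinearly_complete_exceptional:
  assumes V: "dim (UNIV :: 'b set) = 2" and two: "\<forall>t::'a. t = 0 \<or> t = 1"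
  shows "\<not> collinearly_complete (subspace_bisection_geometry 1 1 0 0)"
proof
  assume cc: "collinearly_complete (subspace_bisection_geometry 1 1 0 0)"
  obtain U U' where U: "subspace U" "dim U = 1" and U': "subspace U'" "dim U' = 1"
    and UU': "dim (U \<inter> U') = 0"
    using exists_subspace_pair[of 0 1] V by auto
  have "dim (U \<inter> U') \<noteq> dim U"
    using U(2) UU' by linarith
  then have "U \<noteq> U'"
    by auto
  then obtain V\<^sub>1 V\<^sub>2 where D: "direct_sum_decomposition V\<^sub>1 V\<^sub>2" and d: "dim V\<^sub>1 = 1" "dim V\<^sub>2 = 1"
    and d0: "dim (U \<inter> V\<^sub>1) = 0" "dim (U \<inter> V\<^sub>2) = 0"
    and d0': "(dim (U' \<inter> V\<^sub>1), dim (U' \<inter> V\<^sub>2)) \<in> {(0, 0), (0, 0)}"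
    using common_lineE[OF cc U U'] by metis
  have sub: "subspace V\<^sub>1" "subspace V\<^sub>2" and zero: "V\<^sub>1 \<inter> V\<^sub>2 = {0}"
    using D by (auto simp: direct_sum_decomposition_def)
  have "dim {x + y | x y. x \<in> U \<and> y \<in> U'} = 2"
    using dim_sums_Int[OF U(1) U'(1)] U U' UU' by linarith
  then have sum: "{x + y | x y. x \<in> U \<and> y \<in> U'} = UNIV"
    by (intro subspace_dim_equal) (use U U' V subspace_sums in auto)
  obtain a b where a: "U = {0, a}" and b: "U' = {0, b}"
    using one_dim_eq_doubleton[OF two U] one_dim_eq_doubleton[OF two U'] by metis
  \<comment> \<open>Over the field with two elements, the diagonal is the only line of the plane other than \<open>U\<close> and \<open>U'\<close>.\<close>
  have diag: "a + b \<in> X" if X: "subspace X" "dim X = 1" and "U \<inter> X \<subseteq> {0}" "U' \<inter> X \<subseteq> {0}" for X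
  proof -
    obtain v where v: "v \<noteq> 0" "X = {0, v}"
      using one_dim_eq_doubleton[OF two X] by metis
    obtain x y where "v = x + y" "x \<in> U" "y \<in> U'"
      using sum by blast
    with v that(3,4) show ?thesis
      unfolding a b by auto
  qed
  have "a + b \<in> V\<^sub>1 \<inter> V\<^sub>2"
    using diag[OF sub(1) d(1)] diag[OF sub(2) d(2)] d0 d0' by auto
  \<comment> \<open>Now the sum of \<open>U\<close> and \<open>U'\<close> shrinks to
    \<open>{0, a, b}\<close>, so the nonzero vector of \<open>V\<^sub>1\<close> lies in
    \<open>U\<close> or \<open>U'\<close>, against the trivial intersections.\<close>
  then have "a + b = 0"
    using zero by simp
  then have "{x + y | x y. x \<in> U \<and> y \<in> U'} \<subseteq> {0, a, b}"
    unfolding a b by auto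
  with sum have "UNIV \<subseteq> {0, a, b}"
    by simp
  obtain v where v: "v \<noteq> 0" "V\<^sub>1 = {0, v}"
    using one_dim_eq_doubleton[OF two sub(1) d(1)] by metis
  moreover have "v = a \<or> v = b"
    using v(1) \<open>UNIV \<subseteq> {0, a, b}\<close> by blast
  ultimately show False
    using d0 d0' a b by auto
qed

end

theorem theorem1p2:
  fixes scale :: "'a::{field, finite} \<Rightarrow> 'b::ab_group_add \<Rightarrow> 'b"
    and q m k k\<^sub>1 k\<^sub>2 :: nat
  assumes "vector_space scale"
    and "q = CARD('a)"
    and "k \<ge> 1"
    and "vector_space.dim scale (UNIV :: 'b set) = 2 * k"
    and "0 < m" and "m < 2 * k"
    and "k\<^sub>1 \<le> k\<^sub>2"
    and "vector_space.admissible scale m k k\<^sub>1 k\<^sub>2"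
  shows "collinearly_complete (vector_space.subspace_bisection_geometry scale m k k\<^sub>1 k\<^sub>2) \<longleftrightarrow>
           3 * k\<^sub>2 \<le> k + 1 + m + k\<^sub>1 \<and> (q, m, k, k\<^sub>1, k\<^sub>2) \<noteq> (2, 1, 1, 0, 0)"
proof -
  interpret vector_space scale by fact
  obtain B where B: "B \<subseteq> UNIV" "independent B" "UNIV \<subseteq> span B" "card B = dim UNIV"
    by (rule basis_exists[of UNIV])
  \<comment> \<open>Infinite sets have cardinality 0, so the positive dimension makes
    \<open>B\<close> finite.\<close>
  have "0 < card B"
    using B(4) assms(3,4) by simp
  then have "finite B"
    by (rule card_ge_0_finite)
  moreover have "span B = UNIV"
    using B(3) by blast
  ultimately interpret finite_dimensional_vector_space scale B
    using B(2) by unfold_locales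
  note V = assms(4)
  note adm = admissible_bounds[OF assms(8) V]
  have two: "q = 2 \<longleftrightarrow> (\<forall>t::'a. t = 0 \<or> t = 1)"
  proof
    assume "\<forall>t::'a. t = 0 \<or> t = 1"
    then have "(UNIV :: 'a set) = {0, 1}"
      by auto
    then have "CARD('a) = card {0, 1 :: 'a}"
      by (rule arg_cong[where f = card])
    then show "q = 2"
      using assms(2) by simp
  next
    assume "q = 2"
    then have "card {0, 1 :: 'a} = card (UNIV :: 'a set)"
      using assms(2) by simp
    then have "{0, 1} = (UNIV :: 'a set)"
      by (intro card_subset_eq) auto
    then show "\<forall>t::'a. t = 0 \<or> t = 1"
      by auto
  qed
  show ?thesis
  proof (cases "3 * k\<^sub>2 \<le> k + 1 + m + k\<^sub>1 \<and> (q, m, k, k\<^sub>1, k\<^sub>2) \<noteq> (2, 1, 1, 0, 0)")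
    case True
    then have "\<not> ((\<forall>t::'a. t = 0 \<or> t = 1) \<and> m = 1 \<and> k = 1 \<and> k\<^sub>1 = 0 \<and> k\<^sub>2 = 0)"
      unfolding two[symmetric] by blast
    with True show ?thesis
      using collinearly_completeI[OF V adm(2,3,1,4)] by blast
  next
    case False
    then consider "k + 1 + m + k\<^sub>1 < 3 * k\<^sub>2" | "q = 2" "m = 1" "k = 1" "k\<^sub>1 = 0" "k\<^sub>2 = 0"
      unfolding prod.inject not_le[symmetric] by blast
    then have "\<not> collinearly_complete (subspace_bisection_geometry m k k\<^sub>1 k\<^sub>2)"
    proof cases
      case 1
      then show ?thesis using not_collinearly_complete[OF V adm(2-4)] by simp
    next
      case 2
      have "\<forall>t::'a. t = 0 \<or> t = 1"
        using 2(1) two by blast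
      moreover have "dim (UNIV :: 'b set) = 2"
        using V 2(3) by linarith
      ultimately show ?thesis
        unfolding 2(2-5) by (intro not_collinearly_complete_exceptional)
    qed
    with False show ?thesis by blast
  qed
qed

end
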